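(* Let $E_{f.g.}$ be the equivalence relation on the Polish space $\bigsqcup_{k<\omega}\mathcal N(\widehat F_k)$ of (presentations of) finitely generated profinite groups defined as follows: for $R\in\mathcal N(\widehat F_r)$ and $S\in\mathcal N(\widehat F_k)$, $R\,E_{f.g.}\,S$ if and only if the profinite groups $\widehat F_r/R$ and $\widehat F_k/S$ are isomorphic. Then $E_{f.g.}$ is Borel equivalent to $\mathrm{id}_{\mathbb R}$, the identity (equality) equivalence relation on $\mathbb R$; that is, $E_{f.g.}\le_B \mathrm{id}_{\mathbb R}$ and $\mathrm{id}_{\mathbb R}\le_B E_{f.g.}$.
   Context: A profinite group is a compact, totally disconnected topological group; all profinite groups here are countably based, and finite generation is meant topologically. Isomorphism of profinite groups means isomorphism of topological groups. For $k<\omega$, $\widehat F_k$ denotes the free profinite group on $k$ generators, i.e. the profinite completion of the free group on $k$ generators. Every topologically finitely generated profinite group is isomorphic to $\widehat F_k/R$ for some $k<\omega$ and some closed normal subgroup $R$ of $\widehat F_k$. For a compact Polish group $G$, $\mathcal N(G)$ is the set of closed normal subgroups of $G$. Fixing a bi-invariant metric $\delta$ on $G$ compatible with its topology, $\mathcal N(G)$ carries the Hausdorff metric $\delta_H(A,B)=\max(\sup_{x\in A}\inf_{y\in B}\delta(x,y),\ \sup_{y\in B}\inf_{x\in A}\delta(x,y))$; with it $\mathcal N(G)$ is a closed subset of the compact metric space of nonempty compact subsets of $G$, and hence a compact Polish space. The disjoint union $\bigsqcup_{k<\omega}\mathcal N(\widehat F_k)$ is a Polish space in which $U$ is open iff $U\cap\mathcal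 N(\widehat F_k)$ is open for every $k$. For equivalence relations $E,F$ on Polish spaces $X,Y$, $E\le_B F$ means that there is a Borel function $g:X\to Y$ with $u\,E\,v\Leftrightarrow g(u)\,F\,g(v)$ for all $u,v\in X$. *)

theory Defs
  imports "HOL-Analysis.Analysis" "HOL-Algebra.Coset"
begin

section \<open>Free groups\<close>

text \<open>
  A letter is a generator with a sign: \<open>(a, True)\<close> stands for \<open>a\<close> and \<open>(a, False)\<close> for its
  inverse.  The elements of the free group are the reduced words.
\<close>

fun inv_letter :: "'a \<times> bool \<Rightarrow> 'a \<times> bool" where
  "inv_letter (a, b) = (a, \<not> b)"

fun reduced_word :: "('a \<times> bool) list \<Rightarrow> bool" where
  "reduced_word (x # y # w) \<longleftrightarrow> y \<noteq> inv_letter x \<and> reduced_word (y # w)"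
| "reduced_word w \<longleftrightarrow> True"

fun cons_letter :: "'a \<times> bool \<Rightarrow> ('a \<times> bool) list \<Rightarrow> ('a \<times> bool) list" where
  "cons_letter x [] = [x]"
| "cons_letter x (y # w) = (if y = inv_letter x then w else x # y # w)"

definition free_group :: "'a set \<Rightarrow> ('a \<times> bool) list monoid" where
  "free_group A = \<lparr>carrier = {w. reduced_word w \<and> fst ` set w \<subseteq> A},
     mult = (\<lambda>u v. foldr cons_letter u v), one = []\<rparr>"

lemma inv_letter_inv_letter [simp]: "inv_letter (inv_letter x) = x"
  by (cases x) auto

lemma fst_inv_letter [simp]: "fst (inv_letter x) = fst x"
  by (cases x) auto

lemma reduced_Cons: "reduced_word (x # w) \<longleftrightarrow> reduced_word w \<and> (w = [] \<or> hd w \<noteq> inv_letter x)"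
  by (cases w) auto

lemma reduced_cons_letter: "reduced_word w \<Longrightarrow> reduced_word (cons_letter x w)"
  by (cases w) (auto simp: reduced_Cons)

lemma set_cons_letter: "fst ` set (cons_letter x w) \<subseteq> insert (fst x) (fst ` set w)"
  by (cases w) auto

lemma foldr_cons_letter_closed:
  "reduced_word v \<Longrightarrow> fst ` set u \<subseteq> A \<Longrightarrow> fst ` set v \<subseteq> A \<Longrightarrow>
     reduced_word (foldr cons_letter u v) \<and> fst ` set (foldr cons_letter u v) \<subseteq> A"
proof (induction u)
  case (Cons x u)
  then have "insert (fst x) (fst ` set (foldr cons_letter u v)) \<subseteq> A"
    and "reduced_word (foldr cons_letter u v)"
    by simp_all
  with set_cons_letter[of x "foldr cons_letter u v"] show ?case
    using reduced_cons_letter by (metis comp_apply foldr_Cons order_trans)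
qed auto

lemma cons_letter_inv_letter: "reduced_word w \<Longrightarrow> cons_letter x (cons_letter (inv_letter x) w) = w"
  by (cases w rule: reduced_word.cases) auto

lemma cons_letter_inv_letter': "reduced_word w \<Longrightarrow> cons_letter (inv_letter x) (cons_letter x w) = w"
  using cons_letter_inv_letter[of w "inv_letter x"] by simp

lemma foldr_cons_letter_reduced: "reduced_word w \<Longrightarrow> reduced_word (foldr cons_letter u w)"
  using foldr_cons_letter_closed[of w u UNIV] by simp

lemma foldr_cons_letter_cons_letter:
  assumes "reduced_word u" "reduced_word w"
  shows "foldr cons_letter (cons_letter x u) w = cons_letter x (foldr cons_letter u w)"
proof (cases u)
  case (Cons y u')
  then show ?thesis
    using cons_letter_inv_letter[OF foldr_cons_letter_reduced[OF assms(2), of u'], of x] by auto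
qed auto

lemma foldr_cons_letter_assoc:
  assumes "reduced_word v" "reduced_word w"
  shows "foldr cons_letter (foldr cons_letter u v) w = foldr cons_letter u (foldr cons_letter v w)"
  using assms by (induction u) (auto simp: foldr_cons_letter_cons_letter foldr_cons_letter_reduced)

lemma foldr_cons_letter_Nil: "reduced_word u \<Longrightarrow> foldr cons_letter u [] = u"
proof (induction u)
  case (Cons x u)
  then show ?case by (cases u) auto
qed auto

lemma foldr_cons_letter_inverse:
  "reduced_word v \<Longrightarrow> foldr cons_letter (map inv_letter (rev w)) (foldr cons_letter w v) = v"
proof (induction w arbitrary: v)
  case (Cons x w)
  then show ?case by (simp add: cons_letter_inv_letter' foldr_cons_letter_reduced)
qed auto

lemma group_free_group: "Group.group (free_group A)"
proof (rule groupI)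
  fix u assume u: "u \<in> carrier (free_group A)"
  define v where "v = foldr cons_letter (map inv_letter (rev u)) []"
  have "fst ` set (map inv_letter (rev u)) \<subseteq> A"
    using u by (auto simp: free_group_def)
  then have v: "v \<in> carrier (free_group A)"
    using foldr_cons_letter_closed[of "[]" "map inv_letter (rev u)" A] by (simp add: v_def free_group_def)
  have "foldr cons_letter v u = foldr cons_letter (map inv_letter (rev u)) (foldr cons_letter [] u)"
    unfolding v_def using u by (subst foldr_cons_letter_assoc) (auto simp: free_group_def)
  also have "\<dots> = []"
    using foldr_cons_letter_inverse[of "[]" u] u by (simp add: foldr_cons_letter_Nil free_group_def)
  finally show "\<exists>v\<in>carrier (free_group A). v \<otimes>\<^bsub>free_group A\<^esub> u = \<one>\<^bsub>free_group A\<^esub>"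
    using v by (auto simp: free_group_def)
next
  fix u v assume "u \<in> carrier (free_group A)" "v \<in> carrier (free_group A)"
  then show "u \<otimes>\<^bsub>free_group A\<^esub> v \<in> carrier (free_group A)"
    using foldr_cons_letter_closed[of v u A] by (simp add: free_group_def)
qed (simp_all add: free_group_def foldr_cons_letter_assoc)


section \<open>Profinite completions\<close>

definition finite_index_normal :: "('a, 'b) monoid_scheme \<Rightarrow> 'a set set" where
  "finite_index_normal G = {N. N \<lhd> G \<and> finite (carrier (G Mod N))}"

text \<open>
  The profinite completion is the inverse limit of the finite quotients \<open>G Mod N\<close>.  For
  \<open>M \<subseteq> N\<close> the transition map from \<open>G Mod M\<close> to \<open>G Mod N\<close> sends a coset of \<open>M\<close> to the
  unique coset of \<open>N\<close> containing it, so a family \<open>x\<close> is compatible iff \<open>x M \<subseteq> x N\<close>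
  whenever \<open>M \<subseteq> N\<close>.  Its topology is induced by the product of the discrete topologies.
\<close>

definition profinite_completion :: "('a, 'b) monoid_scheme \<Rightarrow> ('a set \<Rightarrow> 'a set) monoid" where
  "profinite_completion G =
    \<lparr>carrier = {x \<in> (\<Pi>\<^sub>E N\<in>finite_index_normal G. carrier (G Mod N)).
        \<forall>M\<in>finite_index_normal G. \<forall>N\<in>finite_index_normal G. M \<subseteq> N \<longrightarrow> x M \<subseteq> x N},
     mult = (\<lambda>x y. \<lambda>N\<in>finite_index_normal G. x N \<otimes>\<^bsub>G Mod N\<^esub> y N),
     one = (\<lambda>N\<in>finite_index_normal G. \<one>\<^bsub>G Mod N\<^esub>)\<rparr>"

definition profinite_completion_topology ::
    "('a, 'b) monoid_scheme \<Rightarrow> ('a set \<Rightarrow> 'a set) topology" where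
  "profinite_completion_topology G =
     subtopology
       (product_topology (\<lambda>N. discrete_topology (carrier (G Mod N))) (finite_index_normal G))
       (carrier (profinite_completion G))"

lemma topspace_profinite_completion_topology [simp]:
  "topspace (profinite_completion_topology G) = carrier (profinite_completion G)"
  by (auto simp: profinite_completion_topology_def profinite_completion_def)

lemma group_profinite_completion:
  assumes "Group.group G"
  shows "Group.group (profinite_completion G)"
proof (rule groupI)
  let ?I = "finite_index_normal G" and ?P = "profinite_completion G"
  have I: "N \<lhd> G" if "N \<in> ?I" for N
    using that by (simp add: finite_index_normal_def)
  have Q: "Group.group (G Mod N)" if "N \<in> ?I" for N
    using I[OF that] by (rule normal.factorgroup_is_group)
  have carr: "x N \<in> carrier (G Mod N)" if "x \<in> carrier ?P" "N \<in> ?I" for x N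
    using that by (auto simp: profinite_completion_def)
  have ext: "x = y" if "x \<in> carrier ?P" "y \<in> carrier ?P" "\<And>N. N \<in> ?I \<Longrightarrow> x N = y N" for x y
    using that by (auto simp: profinite_completion_def intro: PiE_ext)
  have mult: "(x \<otimes>\<^bsub>?P\<^esub> y) N = x N \<otimes>\<^bsub>G Mod N\<^esub> y N" if "N \<in> ?I" for x y N
    using that by (simp add: profinite_completion_def)
  have one: "\<one>\<^bsub>?P\<^esub> N = \<one>\<^bsub>G Mod N\<^esub>" if "N \<in> ?I" for N
    using that by (simp add: profinite_completion_def)
  show mult_closed: "x \<otimes>\<^bsub>?P\<^esub> y \<in> carrier ?P" if "x \<in> carrier ?P" "y \<in> carrier ?P" for x y
  proof -
    have "x N \<otimes>\<^bsub>G Mod N\<^esub> y N \<in> carrier (G Mod N)" if "N \<in> ?I" for N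
      using Q[OF that] carr that \<open>x \<in> _\<close> \<open>y \<in> _\<close> by (meson group.is_monoid monoid.m_closed)
    then show ?thesis
      using that unfolding profinite_completion_def by (auto intro!: mono_set_mult del: subsetI)
  qed
  show one_closed: "\<one>\<^bsub>?P\<^esub> \<in> carrier ?P"
    using Q[THEN group.is_monoid, THEN monoid.one_closed]
    by (auto simp: profinite_completion_def del: one_FactGroup) 
  show "x \<otimes>\<^bsub>?P\<^esub> y \<otimes>\<^bsub>?P\<^esub> z = x \<otimes>\<^bsub>?P\<^esub> (y \<otimes>\<^bsub>?P\<^esub> z)"
    if "x \<in> carrier ?P" "y \<in> carrier ?P" "z \<in> carrier ?P" for x y z
  proof (rule ext)
    fix N assume N: "N \<in> ?I"
    then show "(x \<otimes>\<^bsub>?P\<^esub> y \<otimes>\<^bsub>?P\<^esub> z) N = (x \<otimes>\<^bsub>?P\<^esub> (y \<otimes>\<^bsub>?P\<^esub> z)) N"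
      using monoid.m_assoc[OF group.is_monoid[OF Q[OF N]], of "x N" "y N" "z N"] carr that
      by (simp add: mult del: mult_FactGroup)
  qed (use that mult_closed in auto)
  show "\<one>\<^bsub>?P\<^esub> \<otimes>\<^bsub>?P\<^esub> x = x" if "x \<in> carrier ?P" for x
  proof (rule ext)
    fix N assume N: "N \<in> ?I"
    then show "(\<one>\<^bsub>?P\<^esub> \<otimes>\<^bsub>?P\<^esub> x) N = x N"
      using monoid.l_one[OF group.is_monoid[OF Q[OF N]], of "x N"] carr that
      by (simp add: mult one del: mult_FactGroup one_FactGroup)
  qed (use that mult_closed one_closed in auto)
  show "\<exists>y\<in>carrier ?P. y \<otimes>\<^bsub>?P\<^esub> x = \<one>\<^bsub>?P\<^esub>" if x: "x \<in> carrier ?P" for x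
  proof
    let ?y = "\<lambda>N\<in>?I. inv\<^bsub>G Mod N\<^esub> (x N)"
    have "?y N \<in> carrier (G Mod N)" if "N \<in> ?I" for N
      using that carr[OF x that] Q[OF that] by (simp add: group.inv_closed)
    moreover have "?y M \<subseteq> ?y N" if "M \<in> ?I" "N \<in> ?I" "M \<subseteq> N" for M N
    proof -
      have "x M \<subseteq> x N"
        using that x by (simp add: profinite_completion_def)
      moreover have "?y L = set_inv\<^bsub>G\<^esub> (x L)" if "L \<in> ?I" for L
        using that carr[OF x that] I[OF that] by (simp add: normal.inv_FactGroup)
      ultimately show ?thesis
        using that by (force simp: SET_INV_def)
    qed
    ultimately show y: "?y \<in> carrier ?P"
      unfolding profinite_completion_def by (simp add: PiE_iff del: restrict_apply)
    show "?y \<otimes>\<^bsub>?P\<^esub> x = \<one>\<^bsub>?P\<^esub>"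
    proof (rule ext)
      fix N assume N: "N \<in> ?I"
      then show "(?y \<otimes>\<^bsub>?P\<^esub> x) N = \<one>\<^bsub>?P\<^esub> N"
        using group.l_inv[OF Q[OF N] carr[OF x N]]
        by (simp add: mult one del: mult_FactGroup one_FactGroup)
    qed (use x y mult_closed one_closed in auto)
  qed
qed

type_synonym free_profinite_elem = "(nat \<times> bool) list set \<Rightarrow> (nat \<times> bool) list set"

definition free_profinite :: "nat \<Rightarrow> free_profinite_elem monoid" where
  "free_profinite k = profinite_completion (free_group {..<k})"

definition free_profinite_topology :: "nat \<Rightarrow> free_profinite_elem topology" where
  "free_profinite_topology k = profinite_completion_topology (free_group {..<k})"


section \<open>Quotients and isomorphisms of topological groups\<close>

definition quotient_topology :: "'a topology \<Rightarrow> ('a \<Rightarrow> 'b) \<Rightarrow> 'b topology" where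
  "quotient_topology X f =
     topology (\<lambda>U. U \<subseteq> f ` topspace X \<and> openin X {x \<in> topspace X. f x \<in> U})"

lemma openin_quotient_topology:
  "openin (quotient_topology X f) U \<longleftrightarrow>
     U \<subseteq> f ` topspace X \<and> openin X {x \<in> topspace X. f x \<in> U}"
proof -
  have "istopology (\<lambda>U. U \<subseteq> f ` topspace X \<and> openin X {x \<in> topspace X. f x \<in> U})"
    unfolding istopology_def
  proof (intro conjI allI impI)
    fix S T
    assume "S \<subseteq> f ` topspace X \<and> openin X {x \<in> topspace X. f x \<in> S}"
      and "T \<subseteq> f ` topspace X \<and> openin X {x \<in> topspace X. f x \<in> T}"
    then have "openin X ({x \<in> topspace X. f x \<in> S} \<inter> {x \<in> topspace X. f x \<in> T})"
      by blast
    then show "openin X {x \<in> topspace X. f x \<in> S \<inter> T}"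
      by (rule back_subst[of "openin X"]) auto
  next
    fix \<K>
    assume "\<forall>K\<in>\<K>. K \<subseteq> f ` topspace X \<and> openin X {x \<in> topspace X. f x \<in> K}"
    then have "openin X (\<Union>K\<in>\<K>. {x \<in> topspace X. f x \<in> K})"
      by blast
    then show "openin X {x \<in> topspace X. f x \<in> \<Union> \<K>}"
      by (rule back_subst[of "openin X"]) auto
  qed auto
  then show ?thesis
    by (simp add: quotient_topology_def topology_inverse')
qed

lemma topspace_quotient_topology [simp]: "topspace (quotient_topology X f) = f ` topspace X"
proof (rule subset_antisym)
  show "topspace (quotient_topology X f) \<subseteq> f ` topspace X"
    using openin_topspace[of "quotient_topology X f"] unfolding openin_quotient_topology by blast
  have "{x \<in> topspace X. f x \<in> f ` topspace X} = topspace X"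
    by auto
  then have "openin (quotient_topology X f) (f ` topspace X)"
    unfolding openin_quotient_topology by simp
  then show "f ` topspace X \<subseteq> topspace (quotient_topology X f)"
    by (rule openin_subset)
qed

lemma quotient_map_quotient_topology: "quotient_map X (quotient_topology X f) f"
  unfolding quotient_map_def openin_quotient_topology topspace_quotient_topology by blast

definition FactGroup_topology ::
    "('a, 'b) monoid_scheme \<Rightarrow> 'a topology \<Rightarrow> 'a set \<Rightarrow> 'a set topology" where
  "FactGroup_topology G T N = quotient_topology T (\<lambda>x. N #>\<^bsub>G\<^esub> x)"

definition topological_group_isomorphic ::
    "('a, 'c) monoid_scheme \<Rightarrow> 'a topology \<Rightarrow> ('b, 'd) monoid_scheme \<Rightarrow> 'b topology \<Rightarrow> bool" where
  "topological_group_isomorphic G S H T \<longleftrightarrow> (\<exists>h\<in>iso G H. homeomorphic_map S T h)"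


section \<open>The space of closed normal subgroups\<close>

definition closed_normal_subgroups ::
    "('a, 'b) monoid_scheme \<Rightarrow> 'a topology \<Rightarrow> 'a set set" where
  "closed_normal_subgroups G T = {N. N \<lhd> G \<and> closedin T N}"

definition compatible_biinvariant_metric ::
    "('a, 'b) monoid_scheme \<Rightarrow> 'a topology \<Rightarrow> ('a \<Rightarrow> 'a \<Rightarrow> real) \<Rightarrow> bool" where
  "compatible_biinvariant_metric G T \<delta> \<longleftrightarrow>
     Metric_space (carrier G) \<delta> \<and> Metric_space.mtopology (carrier G) \<delta> = T \<and>
     (\<forall>g\<in>carrier G. \<forall>x\<in>carrier G. \<forall>y\<in>carrier G.
        \<delta> (g \<otimes>\<^bsub>G\<^esub> x) (g \<otimes>\<^bsub>G\<^esub> y) = \<delta> x y \<and> \<delta> (x \<otimes>\<^bsub>G\<^esub> g) (y \<otimes>\<^bsub>G\<^esub> g) = \<delta> x y)"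

text \<open>
  The locale \<open>Metric_space\<close> asks for nonnegativity and symmetry on the whole type, hence the
  value 0 outside of the family \<open>\<K>\<close>.
\<close>

definition Hausdorff_metric ::
    "'a set set \<Rightarrow> ('a \<Rightarrow> 'a \<Rightarrow> real) \<Rightarrow> 'a set \<Rightarrow> 'a set \<Rightarrow> real" where
  "Hausdorff_metric \<K> \<delta> A B =
     (if A \<in> \<K> \<and> B \<in> \<K>
      then max (SUP x\<in>A. INF y\<in>B. \<delta> x y) (SUP y\<in>B. INF x\<in>A. \<delta> x y)
      else 0)"

definition closed_normal_subgroups_topology ::
    "('a, 'b) monoid_scheme \<Rightarrow> 'a topology \<Rightarrow> ('a \<Rightarrow> 'a \<Rightarrow> real) \<Rightarrow> 'a set topology" where
  "closed_normal_subgroups_topology G T \<delta> =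
     Metric_space.mtopology (closed_normal_subgroups G T)
       (Hausdorff_metric (closed_normal_subgroups G T) \<delta>)"

definition fg_presentations ::
    "(nat \<Rightarrow> free_profinite_elem \<Rightarrow> free_profinite_elem \<Rightarrow> real)
      \<Rightarrow> (nat \<times> free_profinite_elem set) topology" where
  "fg_presentations \<delta> =
     sum_topology
       (\<lambda>k. closed_normal_subgroups_topology (free_profinite k) (free_profinite_topology k) (\<delta> k))
       UNIV"

definition E_fg :: "nat \<times> free_profinite_elem set \<Rightarrow> nat \<times> free_profinite_elem set \<Rightarrow> bool" where
  "E_fg = (\<lambda>(r, R) (k, S).
     topological_group_isomorphic
       (free_profinite r Mod R) (FactGroup_topology (free_profinite r) (free_profinite_topology r) R)
       (free_profinite k Mod S) (FactGroup_topology (free_profinite k) (free_profinite_topology k) S))"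


section \<open>Borel reducibility\<close>

definition borel_of :: "'a topology \<Rightarrow> 'a measure" where
  "borel_of X = sigma (topspace X) {U. openin X U}"

lemma borel_of_euclidean: "borel_of euclidean = borel"
  by (simp add: borel_of_def borel_def)

text \<open>
  A relation on a space \<open>X\<close> is a binary predicate on the ambient type, of which only the values
  on \<open>topspace X\<close> matter.
\<close>

definition borel_reducible ::
    "'a topology \<Rightarrow> ('a \<Rightarrow> 'a \<Rightarrow> bool) \<Rightarrow> 'b topology \<Rightarrow> ('b \<Rightarrow> 'b \<Rightarrow> bool) \<Rightarrow> bool" where
  "borel_reducible X E Y F \<longleftrightarrow>
     (\<exists>g\<in>measurable (borel_of X) (borel_of Y).
        \<forall>u\<in>topspace X. \<forall>v\<in>topspace X. E u v \<longleftrightarrow> F (g u) (g v))"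

definition borel_equivalent ::
    "'a topology \<Rightarrow> ('a \<Rightarrow> 'a \<Rightarrow> bool) \<Rightarrow> 'b topology \<Rightarrow> ('b \<Rightarrow> 'b \<Rightarrow> bool) \<Rightarrow> bool" where
  "borel_equivalent X E Y F \<longleftrightarrow> borel_reducible X E Y F \<and> borel_reducible Y F X E"

end

theory Submission
  imports Defs
begin

text \<open>
  A topologically finitely generated profinite group has, for each \<open>n\<close>, only finitely many
  continuous maps onto multiplication tables of size \<open>n\<close>.  If every finite quotient of \<open>H\<close>
  is a quotient of \<open>G\<close>, Tychonoff compactness glues approximations into a continuous
  epimorphism \<open>G \<rightarrow> H\<close>; since finitely generated profinite groups are Hopfian, groups with
  the same finite quotients are isomorphic.  Thus the set of multiplication tables of finite
  quotients is a complete invariant, and each table occurs on an open set of presentations, so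
  the invariant is a Borel map to the subsets of a countable set.

  Conversely, for a set \<open>A\<close> of primes let \<open>R\<close> be the intersection of the kernels of maps onto
  \<open>\<int>/p\<close>, one for each \<open>p \<in> A\<close>.  The quotient by \<open>R\<close> has \<open>\<int>/p\<close> as a quotient iff \<open>p \<in> A\<close>.
  Indexing the primes by the rationals and taking for \<open>A\<close> the Dedekind cut of a real number
  gives a left-continuous, hence Borel, reduction of equality on the reals.
\<close>

text \<open>Quotients of different groups are compared through maps to initial segments of
  \<open>nat\<close>, whose tables range over one countable type. For a fixed size these maps form a
  finite set; this finiteness stands in for finite generation and passes to quotients, so one
  abstract class covers every \<open>free_profinite k Mod R\<close>.

  The obstacle is that equality of finite quotients gives, at each level, some surjection between
  the quotients there, without any compatibility between levels. Compactness repairs this: the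
  approximations are arbitrary functions, homomorphic and continuous only after composition with the
  maps of bounded size. Their cluster point satisfies all these conditions at once, and finiteness
  of the sets of maps keeps the composites continuous in the limit.

  For the lower bound one generator suffices: the group coded by A is then the product of the groups
  Z/p over p in A. Primes are used because a power that kills finitely many of these factors still
  acts invertibly modulo any other prime. At a rational r the prime of r enters the cut immediately
  to the right of r, which is why continuity is one-sided.\<close>

section \<open>Groups determined by their finite quotients\<close>

text \<open>The fibres form a congruence; in a group they are thus the cosets of an open normal
  subgroup, of index at most \<open>n\<close>. No operation on the target is fixed and the map need
  not be onto, so composites with other maps stay in such sets. Extensionality makes it possible for
  the set to be finite.\<close>

definition finite_quotient_maps :: "('a, 'b) monoid_scheme \<Rightarrow> 'a topology \<Rightarrow> nat \<Rightarrow> ('a \<Rightarrow> nat) set" where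
  "finite_quotient_maps G T n = {f \<in> carrier G \<rightarrow>\<^sub>E {..<n}.
     (\<forall>x\<in>carrier G. \<forall>x'\<in>carrier G. \<forall>y\<in>carrier G. \<forall>y'\<in>carrier G.
        f x = f x' \<longrightarrow> f y = f y' \<longrightarrow> f (x \<otimes>\<^bsub>G\<^esub> y) = f (x' \<otimes>\<^bsub>G\<^esub> y')) \<and>
     (\<forall>i. openin T {x \<in> carrier G. f x = i})}"

text \<open>The operation of the quotient is stored in \<open>c\<close>, so the finite quotients of
  a group become a subset of the countable type \<open>nat list list\<close>, independent of the
  type of the group.\<close>

definition has_quotient_table :: "('a, 'b) monoid_scheme \<Rightarrow> 'a topology \<Rightarrow> nat list list \<Rightarrow> bool" where
  "has_quotient_table G T c \<longleftrightarrow> (\<exists>f. f ` carrier G = {..<length c} \<and>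
     (\<forall>x\<in>carrier G. \<forall>y\<in>carrier G. f (x \<otimes>\<^bsub>G\<^esub> y) = c ! f x ! f y) \<and>
     (\<forall>i. openin T {x \<in> carrier G. f x = i}))"

lemma finite_quotient_maps_mult:
  assumes "f \<in> finite_quotient_maps G T n" "f x = f x'" "f y = f y'"
    "x \<in> carrier G" "x' \<in> carrier G" "y \<in> carrier G" "y' \<in> carrier G"
  shows "f (x \<otimes>\<^bsub>G\<^esub> y) = f (x' \<otimes>\<^bsub>G\<^esub> y')"
  using assms unfolding finite_quotient_maps_def by blast

lemma finite_quotient_maps_PiE:
  "f \<in> finite_quotient_maps G T n \<Longrightarrow> f \<in> carrier G \<rightarrow>\<^sub>E {..<n}"
  by (simp add: finite_quotient_maps_def)

lemma finite_quotient_maps_less: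
  "f \<in> finite_quotient_maps G T n \<Longrightarrow> x \<in> carrier G \<Longrightarrow> f x < n"
  by (drule finite_quotient_maps_PiE) auto

lemma finite_quotient_mapsI:
  assumes "f \<in> carrier G \<rightarrow>\<^sub>E {..<n}"
    "\<And>x x' y y'. x \<in> carrier G \<Longrightarrow> x' \<in> carrier G \<Longrightarrow> y \<in> carrier G \<Longrightarrow> y' \<in> carrier G \<Longrightarrow>
      f x = f x' \<Longrightarrow> f y = f y' \<Longrightarrow> f (x \<otimes>\<^bsub>G\<^esub> y) = f (x' \<otimes>\<^bsub>G\<^esub> y')"
    "\<And>i. openin T {x \<in> carrier G. f x = i}"
  shows "f \<in> finite_quotient_maps G T n"
  unfolding finite_quotient_maps_def
  by (intro CollectI conjI ballI allI impI) (rule assms; assumption)+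

lemma openin_fibre:
  "f \<in> finite_quotient_maps G T n \<Longrightarrow> openin T {x \<in> carrier G. f x = i}"
  by (simp add: finite_quotient_maps_def)

text \<open>Serves in both directions: to treat a map of small size at a later stage, and to bring a
  map back to the small bound that its values obey.\<close>

lemma finite_quotient_maps_change_bound:
  assumes "f \<in> finite_quotient_maps G T m" "\<And>x. x \<in> carrier G \<Longrightarrow> f x < n"
  shows "f \<in> finite_quotient_maps G T n"
proof (rule finite_quotient_mapsI)
  show "f \<in> carrier G \<rightarrow>\<^sub>E {..<n}"
    using finite_quotient_maps_PiE[OF assms(1)] assms(2) by (auto simp: PiE_iff)
qed ((rule finite_quotient_maps_mult[OF assms(1)]; assumption) | rule openin_fibre[OF assms(1)])+

lemma has_quotient_table_topological_group_isomorphic: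
  assumes "topological_group_isomorphic G S H T" "has_quotient_table H T c"
    and S: "topspace S = carrier G"
  shows "has_quotient_table G S c"
proof -
  obtain h where h: "h \<in> iso G H" "homeomorphic_map S T h"
    using assms(1) by (auto simp: topological_group_isomorphic_def)
  obtain f where f: "f ` carrier H = {..<length c}"
    "\<And>x y. x \<in> carrier H \<Longrightarrow> y \<in> carrier H \<Longrightarrow> f (x \<otimes>\<^bsub>H\<^esub> y) = c ! f x ! f y"
    "\<And>i. openin T {x \<in> carrier H. f x = i}"
    using assms(2) by (auto simp: has_quotient_table_def)
  have hc: "h ` carrier G = carrier H" "\<And>x. x \<in> carrier G \<Longrightarrow> h x \<in> carrier H"
    "\<And>x y. x \<in> carrier G \<Longrightarrow> y \<in> carrier G \<Longrightarrow> h (x \<otimes>\<^bsub>G\<^esub> y) = h x \<otimes>\<^bsub>H\<^esub> h y"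
    using h(1) by (auto simp: iso_def bij_betw_def hom_def)
  have "openin S {x \<in> carrier G. (f \<circ> h) x = i}" for i
  proof -
    have "continuous_map S T h"
      using h(2) by (rule homeomorphic_imp_continuous_map)
    then have "openin S {x \<in> topspace S. h x \<in> {x \<in> carrier H. f x = i}}"
      using f(3) by (rule openin_continuous_map_preimage)
    also have "{x \<in> topspace S. h x \<in> {x \<in> carrier H. f x = i}} = {x \<in> carrier G. (f \<circ> h) x = i}"
      using hc(2) S by auto
    finally show ?thesis .
  qed
  moreover have "(f \<circ> h) ` carrier G = {..<length c}"
    by (simp only: image_comp [symmetric] hc(1) f(1))
  ultimately show ?thesis
    unfolding has_quotient_table_def using f(2) hc(2,3) by (intro exI[of _ "f \<circ> h"]) auto
qed

lemma topological_group_isomorphic_sym: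
  assumes "topological_group_isomorphic G S H T" "Group.group G"
    and S: "topspace S = carrier G"
  shows "topological_group_isomorphic H T G S"
proof -
  obtain h where h: "h \<in> iso G H" "homeomorphic_map S T h"
    using assms(1) by (auto simp: topological_group_isomorphic_def)
  obtain k where k: "homeomorphic_maps S T h k"
    using h(2) homeomorphic_map_maps by blast
  let ?k = "inv_into (carrier G) h"
  have "?k y = k y" if "y \<in> topspace T" for y
    using k that S h(1) by (intro inv_into_f_eq) (auto simp: homeomorphic_maps_def iso_def bij_betw_def continuous_map_def)
  moreover have "homeomorphic_map T S k"
    using k homeomorphic_map_maps homeomorphic_maps_sym by blast
  ultimately have "homeomorphic_map T S ?k"
    using homeomorphic_map_eq by metis
  moreover have "?k \<in> iso H G"
    using assms(2) h(1) by (rule group.iso_set_sym)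
  ultimately show ?thesis
    by (auto simp: topological_group_isomorphic_def)
qed

text \<open>Products of arbitrarily chosen representatives fill the table; the congruence property
  makes the entries independent of the choice.\<close>

lemma multiplication_table:
  assumes f: "f \<in> finite_quotient_maps G T n" "f ` carrier G = {..<n}"
  obtains c where "length c = n"
    "\<And>x y. x \<in> carrier G \<Longrightarrow> y \<in> carrier G \<Longrightarrow> f (x \<otimes>\<^bsub>G\<^esub> y) = c ! f x ! f y"
proof
  define r where "r = inv_into (carrier G) f"
  define c where "c = map (\<lambda>i. map (\<lambda>j. f (r i \<otimes>\<^bsub>G\<^esub> r j)) [0..<n]) [0..<n]"
  show "length c = n"
    by (simp add: c_def)
  have r: "r (f x) \<in> carrier G" "f (r (f x)) = f x" if "x \<in> carrier G" for x
    using that by (auto simp: r_def inv_into_into f_inv_into_f)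
  show "f (x \<otimes>\<^bsub>G\<^esub> y) = c ! f x ! f y" if "x \<in> carrier G" "y \<in> carrier G" for x y
    using finite_quotient_maps_mult[OF f(1), of x "r (f x)" y "r (f y)"] r that
      finite_quotient_maps_less[OF f(1)] by (simp add: c_def)
qed

text \<open>The closures of the tails are nested, nonempty and closed. A cluster point is all that
  can be asked for: the lemma is applied to a product indexed by a whole group, where convergent
  subsequences need not exist.\<close>

lemma compact_space_cluster_point:
  fixes s :: "nat \<Rightarrow> 'a"
  assumes "compact_space X" "\<And>n. s n \<in> topspace X"
  obtains l where "l \<in> topspace X" "\<And>U m. openin X U \<Longrightarrow> l \<in> U \<Longrightarrow> \<exists>n\<ge>m. s n \<in> U"
proof -
  have "(\<Inter>m. X closure_of (s ` {m..})) \<noteq> {}"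
  proof (rule compact_space_imp_nest[OF assms(1)])
    fix n
    show "closedin X (X closure_of s ` {n..})"
      by simp
    have "s n \<in> X closure_of s ` {n..}"
      using assms(2) by (auto simp: in_closure_of)
    then show "X closure_of s ` {n..} \<noteq> {}"
      by blast
  qed (auto simp: decseq_def intro!: closure_of_mono)
  then obtain l where l: "\<And>m. l \<in> X closure_of (s ` {m..})"
    by blast
  show thesis
  proof
    show "l \<in> topspace X"
      using l[of 0] by (simp add: in_closure_of)
    show "\<exists>n\<ge>m. s n \<in> U" if "openin X U" "l \<in> U" for U m
      using l[of m] that by (fastforce simp: in_closure_of)
  qed
qed

text \<open>\<open>fibre_base\<close> expresses that the topology comes from finite quotients, and
  \<open>finite_finite_quotient_maps\<close> replaces a finite generating set. In this form the
  properties can be checked for quotients without choosing generators in them.\<close>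

locale fg_profinite = Group.group G for G (structure) +
  fixes T
  assumes topspace_eq: "topspace T = carrier G"
    and compact: "compact_space T"
    and t1: "t1_space T"
    and fibre_base: "\<And>U x. openin T U \<Longrightarrow> x \<in> U \<Longrightarrow>
      \<exists>n. \<exists>f\<in>finite_quotient_maps G T n. \<forall>y\<in>carrier G. f y = f x \<longrightarrow> y \<in> U"
    and finite_finite_quotient_maps: "\<And>n. finite (finite_quotient_maps G T n)"
begin

lemma finite_quotient_maps_separate:
  assumes "x \<in> carrier G" "y \<in> carrier G"
    "\<And>n f. f \<in> finite_quotient_maps G T n \<Longrightarrow> f x = f y"
  shows "x = y"
proof (rule ccontr)
  assume "x \<noteq> y"
  have "closedin T {y}"
    using t1 assms(2) topspace_eq by (simp add: t1_space_closedin_singleton)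
  then have "openin T (topspace T - {y})"
    by (simp add: closedin_def)
  moreover have "x \<in> topspace T - {y}"
    using assms(1) \<open>x \<noteq> y\<close> topspace_eq by simp
  ultimately obtain n f where f: "f \<in> finite_quotient_maps G T n"
    "\<forall>z\<in>carrier G. f z = f x \<longrightarrow> z \<in> topspace T - {y}"
    using fibre_base by blast
  then show False
    using assms(2) assms(3)[OF f(1)] by auto
qed

lemma Hausdorff: "Hausdorff_space T"
  unfolding Hausdorff_space_def
proof (intro allI impI)
  fix x y assume xy: "x \<in> topspace T \<and> y \<in> topspace T \<and> x \<noteq> y"
  then obtain n f where f: "f \<in> finite_quotient_maps G T n" "f x \<noteq> f y"
    using finite_quotient_maps_separate topspace_eq by blast
  then show "\<exists>U V. openin T U \<and> openin T V \<and> x \<in> U \<and> y \<in> V \<and> disjnt U V"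
    using xy topspace_eq openin_fibre[OF f(1)]
    by (intro exI[of _ "{z \<in> carrier G. f z = f x}"] exI[of _ "{z \<in> carrier G. f z = f y}"])
      (auto simp: disjnt_def)
qed

text \<open>All maps of bound \<open>n\<close> are combined into a single one, so that a single
  table controls them simultaneously. This is possible because there are finitely many.\<close>

lemma common_refinement:
  obtains N f where "f \<in> finite_quotient_maps G T N" "f ` carrier G = {..<N}"
    "\<And>g x y. g \<in> finite_quotient_maps G T n \<Longrightarrow> x \<in> carrier G \<Longrightarrow> y \<in> carrier G \<Longrightarrow>
      f x = f y \<Longrightarrow> g x = g y"
proof -
  let ?M = "finite_quotient_maps G T n"
  \<comment> \<open>The tuple of values at \<open>x\<close> of all maps of bound \<open>n\<close>;
    \<open>e\<close> numbers the tuples that occur, which makes \<open>f\<close> onto an initial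
    segment.\<close>
  define k where "k x = restrict (\<lambda>g. g x) ?M" for x
  have "k ` carrier G \<subseteq> ?M \<rightarrow>\<^sub>E {..<n}"
    using finite_quotient_maps_less[of _ G T n] by (auto simp: k_def)
  then have "finite (k ` carrier G)"
    using finite_finite_quotient_maps by (metis finite_PiE finite_lessThan finite_subset)
  then obtain e where e: "bij_betw e (k ` carrier G) {0..<card (k ` carrier G)}"
    using ex_bij_betw_finite_nat by blast
  let ?N = "card (k ` carrier G)"
  define f where "f = restrict (e \<circ> k) (carrier G)"
  have k_eq: "k x = k y \<longleftrightarrow> (\<forall>g\<in>?M. g x = g y)" for x y
    by (auto simp: k_def fun_eq_iff)
  have f_eq: "f x = f y \<longleftrightarrow> (\<forall>g\<in>?M. g x = g y)" if "x \<in> carrier G" "y \<in> carrier G" for x y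
  proof -
    have "e (k x) = e (k y) \<longleftrightarrow> k x = k y"
      using e that by (intro inj_on_eq_iff[of e "k ` carrier G"]) (auto simp: bij_betw_def)
    then show ?thesis
      using that by (simp add: f_def k_eq)
  qed
  have im: "f ` carrier G = {..<?N}"
    using e by (auto simp: f_def bij_betw_def image_comp lessThan_atLeast0)
  have "f \<in> finite_quotient_maps G T ?N"
  proof (rule finite_quotient_mapsI)
    show "openin T {x \<in> carrier G. f x = i}" for i
    proof (cases "\<exists>x0\<in>carrier G. f x0 = i")
      case True
      then obtain x0 where x0: "x0 \<in> carrier G" "f x0 = i"
        by blast
      have "openin T ((\<Inter>g\<in>?M. {x \<in> carrier G. g x = g x0}) \<inter> topspace T)"
        using finite_finite_quotient_maps openin_fibre by (intro openin_INT) auto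
      also have "(\<Inter>g\<in>?M. {x \<in> carrier G. g x = g x0}) \<inter> topspace T = {x \<in> carrier G. f x = i}"
        using x0 f_eq topspace_eq by auto
      finally show ?thesis .
    next
      case False
      then have "{x \<in> carrier G. f x = i} = {}"
        by blast
      then show ?thesis
        by (metis openin_empty)
    qed
    show "f (x \<otimes> y) = f (x' \<otimes> y')"
      if "x \<in> carrier G" "y \<in> carrier G" "x' \<in> carrier G" "y' \<in> carrier G" "f x = f x'" "f y = f y'"
      for x y x' y'
      using that finite_quotient_maps_mult[of _ G T n] by (simp add: f_eq)
    show "f \<in> carrier G \<rightarrow>\<^sub>E {..<?N}"
      using im by (intro PiE_I) (auto simp: f_def)
  qed
  with im f_eq show thesis
    by (intro that[of f ?N]) auto
qed

text \<open>
  If \<open>h\<close> is onto, precomposition with \<open>h\<close> is an injection of the finite set of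
  quotient maps of each size, hence a bijection, so no quotient map separates more than \<open>h\<close>.
\<close>

lemma hopfian:
  assumes h: "h \<in> hom G G" "continuous_map T T h" "h ` carrier G = carrier G"
  shows "inj_on h (carrier G)"
proof (rule inj_onI)
  fix x y assume xy: "x \<in> carrier G" "y \<in> carrier G" "h x = h y"
  have hc: "h x \<in> carrier G" if "x \<in> carrier G" for x
    using h(1) that by (auto simp: hom_def)
  show "x = y"
  proof (rule finite_quotient_maps_separate[OF xy(1,2)])
    fix n f assume f: "f \<in> finite_quotient_maps G T n"
    let ?M = "finite_quotient_maps G T n"
    define p where "p g = restrict (g \<circ> h) (carrier G)" for g :: "'a \<Rightarrow> nat"
    have "p g \<in> ?M" if g: "g \<in> ?M" for g
    proof (rule finite_quotient_mapsI)
      show "openin T {x \<in> carrier G. p g x = i}" for i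
      proof -
        have "openin T {x \<in> topspace T. h x \<in> {x \<in> carrier G. g x = i}}"
          using h(2) openin_fibre[OF g] by (rule openin_continuous_map_preimage)
        also have "{x \<in> topspace T. h x \<in> {x \<in> carrier G. g x = i}} = {x \<in> carrier G. p g x = i}"
          using hc topspace_eq by (auto simp: p_def)
        finally show ?thesis .
      qed
      show "p g (x \<otimes> y) = p g (x' \<otimes> y')"
        if "x \<in> carrier G" "y \<in> carrier G" "x' \<in> carrier G" "y' \<in> carrier G"
          "p g x = p g x'" "p g y = p g y'" for x y x' y'
        using that finite_quotient_maps_mult[OF g, of "h x" "h x'" "h y" "h y'"] hc h(1)
        by (simp add: p_def hom_def)
      show "p g \<in> carrier G \<rightarrow>\<^sub>E {..<n}"
        using finite_quotient_maps_less[OF g] hc by (auto simp: p_def)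
    qed
    moreover have "inj_on p ?M"
    proof (rule inj_onI)
      fix g g' assume g: "g \<in> ?M" "g' \<in> ?M" "p g = p g'"
      have "g z = g' z" if z: "z \<in> carrier G" for z
      proof -
        obtain w where "w \<in> carrier G" "z = h w"
          using z h(3) by blast
        then show ?thesis
          using fun_cong[OF g(3), of w] by (simp add: p_def)
      qed
      then show "g = g'"
        by (intro PiE_ext[OF g(1,2)[THEN finite_quotient_maps_PiE]])
    qed
    ultimately have "p ` ?M = ?M"
      using finite_finite_quotient_maps by (intro endo_inj_surj) auto
    then obtain g where "f = p g"
      using f by blast
    then show "f x = f y"
      using xy by (simp add: p_def)
  qed
qed

end

text \<open>The common refinement \<open>F\<close> on \<open>H\<close> has a table, and
  \<open>sub\<close> provides a map \<open>P\<close> on \<open>G\<close> with the same table.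
  Matching the values of \<open>P\<close> and \<open>F\<close> relates the two groups up to the
  fibres of \<open>F\<close>, which no map of bound \<open>n\<close> can see.\<close>

lemma approximate_epimorphism:
  assumes "fg_profinite G S" "fg_profinite H T"
    and sub: "\<And>c. has_quotient_table H T c \<Longrightarrow> has_quotient_table G S c"
  shows "\<exists>h. h \<in> carrier G \<rightarrow> carrier H \<and>
    (\<forall>f\<in>finite_quotient_maps H T n.
       (\<forall>x\<in>carrier G. \<forall>y\<in>carrier G. f (h (x \<otimes>\<^bsub>G\<^esub> y)) = f (h x \<otimes>\<^bsub>H\<^esub> h y)) \<and>
       restrict (f \<circ> h) (carrier G) \<in> finite_quotient_maps G S n \<and>
       f ` h ` carrier G = f ` carrier H)"
proof -
  interpret G: fg_profinite G S by fact
  interpret H: fg_profinite H T by fact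
  obtain N F where F: "F \<in> finite_quotient_maps H T N" "F ` carrier H = {..<N}"
    and Fref: "\<And>g x y. g \<in> finite_quotient_maps H T n \<Longrightarrow> x \<in> carrier H \<Longrightarrow> y \<in> carrier H \<Longrightarrow>
      F x = F y \<Longrightarrow> g x = g y"
    by (rule H.common_refinement[of n], rule that, assumption+)
  obtain c where c: "length c = N"
    "\<And>x y. x \<in> carrier H \<Longrightarrow> y \<in> carrier H \<Longrightarrow> F (x \<otimes>\<^bsub>H\<^esub> y) = c ! F x ! F y"
    using multiplication_table[OF F] by blast
  have "has_quotient_table H T c"
    unfolding has_quotient_table_def using F(2) c openin_fibre[OF F(1)] by (intro exI[of _ F]) auto
  then have "has_quotient_table G S c"
    by (rule sub)
  then obtain P where P: "P ` carrier G = {..<N}"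
    "\<And>x y. x \<in> carrier G \<Longrightarrow> y \<in> carrier G \<Longrightarrow> P (x \<otimes>\<^bsub>G\<^esub> y) = c ! P x ! P y"
    "\<And>i. openin S {x \<in> carrier G. P x = i}"
    using c(1) by (auto simp: has_quotient_table_def)
  \<comment> \<open>An arbitrary choice in the fibre of \<open>F\<close> over \<open>P x\<close>:
    neither multiplicative nor continuous by itself.\<close>
  define h where "h x = inv_into (carrier H) F (P x)" for x
  have h: "h x \<in> carrier H" "F (h x) = P x" if "x \<in> carrier G" for x
  proof -
    have "P x \<in> F ` carrier H"
      using that P(1) F(2) by blast
    then show "h x \<in> carrier H" "F (h x) = P x"
      by (auto simp: h_def inv_into_into f_inv_into_f)
  qed
  have hmult: "f (h (x \<otimes>\<^bsub>G\<^esub> y)) = f (h x \<otimes>\<^bsub>H\<^esub> h y)"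
    if "f \<in> finite_quotient_maps H T n" "x \<in> carrier G" "y \<in> carrier G" for f x y
  proof (rule Fref[OF that(1)])
    show "F (h (x \<otimes>\<^bsub>G\<^esub> y)) = F (h x \<otimes>\<^bsub>H\<^esub> h y)"
      using that(2,3) h by (simp add: P(2) c(2))
  qed (use that h in auto)
  show ?thesis
  proof (intro exI[of _ h] conjI ballI)
    show "h \<in> carrier G \<rightarrow> carrier H"
      using h by auto
    show "f (h (x \<otimes>\<^bsub>G\<^esub> y)) = f (h x \<otimes>\<^bsub>H\<^esub> h y)"
      if "f \<in> finite_quotient_maps H T n" "x \<in> carrier G" "y \<in> carrier G" for f x y
      using hmult that by blast
    fix f assume f: "f \<in> finite_quotient_maps H T n"
    show "f ` h ` carrier G = f ` carrier H"
    proof (intro subset_antisym subsetI)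
      fix i assume "i \<in> f ` carrier H"
      then obtain y where y: "y \<in> carrier H" "i = f y"
        by blast
      then have "F y \<in> P ` carrier G"
        using P(1) F(2) by blast
      then obtain x where x: "x \<in> carrier G" "P x = F y"
        by (metis imageE)
      then have "f (h x) = i"
        using Fref[OF f, of "h x" y] h y by simp
      then show "i \<in> f ` h ` carrier G"
        using x by blast
    qed (use h in auto)
    have fP: "f (h x) = f (h y)" if "x \<in> carrier G" "y \<in> carrier G" "P x = P y" for x y
      by (rule Fref[OF f]) (use that h in auto)
    let ?g = "restrict (f \<circ> h) (carrier G)"
    show "?g \<in> finite_quotient_maps G S n"
    proof (rule finite_quotient_mapsI)
      show "openin S {x \<in> carrier G. ?g x = i}" for i
      proof -
        have "openin S (\<Union>x0\<in>{x \<in> carrier G. ?g x = i}. {x \<in> carrier G. P x = P x0})"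
          using P(3) by blast
        also have "(\<Union>x0\<in>{x \<in> carrier G. ?g x = i}. {x \<in> carrier G. P x = P x0})
            = {x \<in> carrier G. ?g x = i}"
        proof (intro subset_antisym subsetI)
          fix x assume "x \<in> (\<Union>x0\<in>{x \<in> carrier G. ?g x = i}. {x \<in> carrier G. P x = P x0})"
          then obtain x0 where "x \<in> carrier G" "x0 \<in> carrier G" "P x = P x0" "f (h x0) = i"
            by auto
          then show "x \<in> {x \<in> carrier G. ?g x = i}"
            using fP[of x x0] by simp
        qed auto
        finally show ?thesis .
      qed
      show "?g (x \<otimes>\<^bsub>G\<^esub> y) = ?g (x' \<otimes>\<^bsub>G\<^esub> y')"
        if "x \<in> carrier G" "y \<in> carrier G" "x' \<in> carrier G" "y' \<in> carrier G"
          "?g x = ?g x'" "?g y = ?g y'" for x y x' y'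
      proof -
        have "f (h x \<otimes>\<^bsub>H\<^esub> h y) = f (h x' \<otimes>\<^bsub>H\<^esub> h y')"
          by (rule finite_quotient_maps_mult[OF f]) (use that h(1) in auto)
        then show ?thesis
          using that hmult[OF f, of x y] hmult[OF f, of x' y'] by simp
      qed
      show "?g \<in> carrier G \<rightarrow>\<^sub>E {..<n}"
        using finite_quotient_maps_less[OF f] h by auto
    qed
  qed
qed

text \<open>Every required property involves one quotient map of \<open>H\<close> at a time.
  Multiplicativity can be read off at finitely many points, hence survives at a cluster point for
  pointwise convergence; continuity and surjectivity are recovered from the composites.\<close>

lemma continuous_epimorphism:
  assumes "fg_profinite G S" "fg_profinite H T"
    and sub: "\<And>c. has_quotient_table H T c \<Longrightarrow> has_quotient_table G S c"
  obtains h where "h \<in> hom G H" "continuous_map S T h" "h ` carrier G = carrier H"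
proof -
  interpret G: fg_profinite G S by fact
  interpret H: fg_profinite H T by fact
  define Q where "Q n h \<longleftrightarrow> h \<in> carrier G \<rightarrow> carrier H \<and>
    (\<forall>f\<in>finite_quotient_maps H T n.
       (\<forall>x\<in>carrier G. \<forall>y\<in>carrier G. f (h (x \<otimes>\<^bsub>G\<^esub> y)) = f (h x \<otimes>\<^bsub>H\<^esub> h y)) \<and>
       restrict (f \<circ> h) (carrier G) \<in> finite_quotient_maps G S n \<and>
       f ` h ` carrier G = f ` carrier H)" for n h
  have "\<exists>h. Q n h" for n
    unfolding Q_def by (rule approximate_epimorphism[OF assms])
  then obtain s where "\<And>n. Q n (s n)"
    by metis
  note s' = this[unfolded Q_def]
  have s: "s n \<in> carrier G \<rightarrow> carrier H" for n
    using s' by blast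
  have smult: "f (s n (x \<otimes>\<^bsub>G\<^esub> y)) = f (s n x \<otimes>\<^bsub>H\<^esub> s n y)"
    if "f \<in> finite_quotient_maps H T n" "x \<in> carrier G" "y \<in> carrier G" for n f x y
    using s'[of n] that by blast
  have smap: "restrict (f \<circ> s n) (carrier G) \<in> finite_quotient_maps G S n"
    and ssurj: "f ` s n ` carrier G = f ` carrier H"
    if "f \<in> finite_quotient_maps H T n" for n f
    using s'[of n] that by blast+
  \<comment> \<open>Functions from \<open>G\<close> to \<open>H\<close> under pointwise convergence;
    compact by Tychonoff.\<close>
  let ?X = "product_topology (\<lambda>_. T) (carrier G)"
  have "compact_space ?X"
    using H.compact by (simp add: compact_space_product_topology)
  moreover have "restrict (s n) (carrier G) \<in> topspace ?X" for n
    using s[of n] H.topspace_eq by auto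
  ultimately obtain h where hX: "h \<in> topspace ?X"
    and clus: "\<And>U m. openin ?X U \<Longrightarrow> h \<in> U \<Longrightarrow> \<exists>n\<ge>m. restrict (s n) (carrier G) \<in> U"
    by (rule compact_space_cluster_point[where s = "\<lambda>n. restrict (s n) (carrier G)"]) blast+
  have hc: "h x \<in> carrier H" if "x \<in> carrier G" for x
    using hX that H.topspace_eq by auto
  \<comment> \<open>Later approximations satisfy the requirements of all earlier stages, so it does
    no harm that the cluster point controls only some \<open>n\<close> beyond each
    \<open>m\<close>.\<close>
  have mono: "f \<in> finite_quotient_maps H T n" if "f \<in> finite_quotient_maps H T m" "m \<le> n" for f m n
    using that finite_quotient_maps_less[OF that(1)]
    by (intro finite_quotient_maps_change_bound[OF that(1)]) (meson less_le_trans)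
  have approx: "\<exists>n\<ge>m. \<forall>x\<in>A. f (s n x) = f (h x)"
    if f: "f \<in> finite_quotient_maps H T m" and A: "finite A" "A \<subseteq> carrier G" for f m A
  proof -
    define U where "U = (\<Inter>x\<in>A. {k \<in> topspace ?X. k x \<in> {y \<in> carrier H. f y = f (h x)}}) \<inter> topspace ?X"
    have "openin ?X U"
      unfolding U_def
    proof (rule openin_INT[OF A(1)])
      fix x assume "x \<in> A"
      then have "continuous_map ?X T (\<lambda>k. k x)"
        using A(2) by (intro continuous_map_product_projection) auto
      then show "openin ?X {k \<in> topspace ?X. k x \<in> {y \<in> carrier H. f y = f (h x)}}"
        using openin_fibre[OF f] by (rule openin_continuous_map_preimage)
    qed
    moreover have "h \<in> U"
      using hX hc A(2) by (auto simp: U_def)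
    ultimately obtain n where n: "n \<ge> m" "restrict (s n) (carrier G) \<in> U"
      using clus by blast
    have "f (s n x) = f (h x)" if "x \<in> A" for x
    proof -
      have "x \<in> carrier G"
        using that A(2) by blast
      then show ?thesis
        using n(2) that by (force simp: U_def)
    qed
    with n(1) show ?thesis
      by blast
  qed
  have hhom: "h \<in> hom G H"
  proof (rule homI)
    fix x y assume xy: "x \<in> carrier G" "y \<in> carrier G"
    show "h (x \<otimes>\<^bsub>G\<^esub> y) = h x \<otimes>\<^bsub>H\<^esub> h y"
    proof (rule H.finite_quotient_maps_separate)
      fix m f assume f: "f \<in> finite_quotient_maps H T m"
      obtain n where n: "n \<ge> m" "\<forall>z\<in>{x, y, x \<otimes>\<^bsub>G\<^esub> y}. f (s n z) = f (h z)"
        using approx[OF f, of "{x, y, x \<otimes>\<^bsub>G\<^esub> y}"] xy by auto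
      then have "f (h (x \<otimes>\<^bsub>G\<^esub> y)) = f (s n x \<otimes>\<^bsub>H\<^esub> s n y)"
        using smult[OF mono[OF f n(1)] xy] by simp
      also have "\<dots> = f (h x \<otimes>\<^bsub>H\<^esub> h y)"
        using n(2) xy s[of n] hc by (intro finite_quotient_maps_mult[OF f]) auto
      finally show "f (h (x \<otimes>\<^bsub>G\<^esub> y)) = f (h x \<otimes>\<^bsub>H\<^esub> h y)" .
    qed (use xy hc in auto)
  qed (use hc in auto)
  text \<open>
    A function that agrees on every finite set with a member of a finite set of functions
    belongs to that set.
  \<close>
  have hmap: "\<exists>n. restrict (f \<circ> h) (carrier G) \<in> finite_quotient_maps G S n \<and>
      f ` h ` carrier G = f ` carrier H" if f: "f \<in> finite_quotient_maps H T m" for f m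
  proof -
    define M where "M = {restrict (f \<circ> s n) (carrier G) | n. n \<ge> m}"
    \<comment> \<open>The approximation \<open>s n\<close> only promises the bound \<open>n\<close>.
      The composites nevertheless have values below the fixed \<open>m\<close>, so all of them lie
      in one finite set.\<close>
    have lt: "f (s n x) < m" if "x \<in> carrier G" for n x
      using s[of n] that finite_quotient_maps_less[OF f] by auto
    have M: "M \<subseteq> finite_quotient_maps G S m"
    proof
      fix g assume "g \<in> M"
      then obtain n where n: "n \<ge> m" "g = restrict (f \<circ> s n) (carrier G)"
        by (auto simp: M_def)
      then have "g \<in> finite_quotient_maps G S n"
        using smap[OF mono[OF f n(1)]] by simp
      then show "g \<in> finite_quotient_maps G S m"
        by (rule finite_quotient_maps_change_bound) (simp add: n(2) lt)
    qed
    have "restrict (f \<circ> h) (carrier G) \<in> M"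
    proof (rule ccontr)
      assume neg: "restrict (f \<circ> h) (carrier G) \<notin> M"
      have "\<exists>x\<in>carrier G. g x \<noteq> f (h x)" if "g \<in> M" for g
      proof (rule ccontr)
        assume "\<not> ?thesis"
        then have "g = restrict (f \<circ> h) (carrier G)"
          using that by (auto simp: M_def fun_eq_iff)
        then show False
          using that neg by simp
      qed
      \<comment> \<open>\<open>w g\<close> is a point where \<open>g\<close> differs from the limit.
        The finitely many points \<open>w g\<close> are tested together: the member of
        \<open>M\<close> that agrees with the limit at all of them must also agree at its own
        point.\<close>
      then obtain w where w: "\<And>g. g \<in> M \<Longrightarrow> w g \<in> carrier G" "\<And>g. g \<in> M \<Longrightarrow> g (w g) \<noteq> f (h (w g))"
        by metis
      have "finite M"
        using M G.finite_finite_quotient_maps finite_subset by blast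
      then obtain n where n: "n \<ge> m" "\<forall>x\<in>w ` M. f (s n x) = f (h x)"
        using approx[OF f, of "w ` M"] w(1) by blast
      then have g: "restrict (f \<circ> s n) (carrier G) \<in> M"
        by (auto simp: M_def)
      then show False
        using w[OF g] n(2) by auto
    qed
    then obtain n where n: "n \<ge> m" "restrict (f \<circ> h) (carrier G) = restrict (f \<circ> s n) (carrier G)"
      by (auto simp: M_def)
    have "f (h x) = f (s n x)" if "x \<in> carrier G" for x
      using fun_cong[OF n(2), of x] that by simp
    then have "f ` h ` carrier G = f ` s n ` carrier G"
      by (auto simp: image_image)
    then have "f ` h ` carrier G = f ` carrier H"
      using ssurj[OF mono[OF f n(1)]] by simp
    then show ?thesis
      using \<open>restrict (f \<circ> h) (carrier G) \<in> M\<close> M by blast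
  qed
  have hcont: "continuous_map S T h"
    unfolding continuous_map_def
  proof (intro conjI allI impI)
    show "h \<in> topspace S \<rightarrow> topspace T"
      using hc G.topspace_eq H.topspace_eq by auto
    fix U assume U: "openin T U"
    show "openin S {x \<in> topspace S. h x \<in> U}"
    proof (subst openin_subopen, safe)
      fix x assume x: "x \<in> topspace S" "h x \<in> U"
      obtain m f where f: "f \<in> finite_quotient_maps H T m"
        "\<And>y. y \<in> carrier H \<Longrightarrow> f y = f (h x) \<Longrightarrow> y \<in> U"
        using H.fibre_base[OF U x(2)] by blast
      obtain n where n: "restrict (f \<circ> h) (carrier G) \<in> finite_quotient_maps G S n"
        using hmap[OF f(1)] by blast
      show "\<exists>V. openin S V \<and> x \<in> V \<and> V \<subseteq> {x \<in> topspace S. h x \<in> U}"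
        using openin_fibre[OF n, of "f (h x)"] x G.topspace_eq f(2) hc
        by (intro exI[of _ "{y \<in> carrier G. restrict (f \<circ> h) (carrier G) y = f (h x)}"]) auto
    qed
  qed
  \<comment> \<open>The image is compact, hence closed, so a missed point could be separated from it
    by a quotient map of \<open>H\<close>. The composite of that map with \<open>h\<close> has full
    image, which excludes this.\<close>
  have "h ` carrier G = carrier H"
  proof (rule ccontr)
    assume "h ` carrier G \<noteq> carrier H"
    then obtain y where y: "y \<in> carrier H" "y \<notin> h ` carrier G"
      using hc by blast
    have "compactin T (h ` topspace S)"
      using G.compact hcont by (metis compact_space_def image_compactin)
    then have "closedin T (h ` carrier G)"
      using H.Hausdorff G.topspace_eq compactin_imp_closedin by metis
    then have "openin T (topspace T - h ` carrier G)"
      by blast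
    then obtain m f where f: "f \<in> finite_quotient_maps H T m"
      "\<And>z. z \<in> carrier H \<Longrightarrow> f z = f y \<Longrightarrow> z \<notin> h ` carrier G"
      using H.fibre_base[of "topspace T - h ` carrier G" y] y H.topspace_eq by blast
    then have "f y \<notin> f ` h ` carrier G"
      using hc by (metis (no_types, lifting) image_iff)
    then show False
      using hmap[OF f(1)] y(1) by blast
  qed
  with hhom hcont show thesis
    by (rule that)
qed

theorem fg_profinite_determined_by_finite_quotients:
  assumes "fg_profinite G S" "fg_profinite H T"
    and "\<And>c. has_quotient_table G S c \<longleftrightarrow> has_quotient_table H T c"
  shows "topological_group_isomorphic G S H T"
proof -
  interpret G: fg_profinite G S by fact
  interpret H: fg_profinite H T by fact
  obtain h where h: "h \<in> hom G H" "continuous_map S T h" "h ` carrier G = carrier H"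
    using continuous_epimorphism[OF assms(1,2)] assms(3) by blast
  obtain k where k: "k \<in> hom H G" "continuous_map T S k" "k ` carrier H = carrier G"
    using continuous_epimorphism[OF assms(2,1)] assms(3) by blast
  \<comment> \<open>The Hopf property applies to endomorphisms only, hence the detour through the
    composite of epimorphisms in both directions.\<close>
  have "inj_on (k \<circ> h) (carrier G)"
  proof (rule G.hopfian)
    show "(k \<circ> h) ` carrier G = carrier G"
      by (simp only: image_comp [symmetric] h(3) k(3))
  qed (use h k in \<open>auto intro: hom_compose continuous_map_compose\<close>)
  then have inj: "inj_on h (carrier G)"
    by (rule inj_on_imageI2)
  then have "h \<in> iso G H"
    using h by (simp add: iso_def bij_betw_def)
  moreover have "homeomorphic_map S T h"
    using h inj G.compact H.Hausdorff G.topspace_eq H.topspace_eq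
    by (intro continuous_imp_homeomorphic_map) auto
  ultimately show ?thesis
    by (auto simp: topological_group_isomorphic_def)
qed

section \<open>Quotients of profinite completions\<close>

lemma (in Group.group) carrier_finite_index_normal: "carrier G \<in> finite_index_normal G"
proof -
  have "carrier (G Mod carrier G) \<subseteq> {carrier G}"
    using coset_join2[OF _ subgroup_self] by (auto simp: carrier_FactGroup)
  then have "finite (carrier (G Mod carrier G))"
    by (rule finite_subset) simp
  moreover have "carrier G \<lhd> G"
    by (simp add: normal_inv_iff subgroup_self)
  ultimately show ?thesis
    by (simp add: finite_index_normal_def)
qed

lemma (in Group.group) r_coset_Int:
  assumes "subgroup M G" "subgroup N G" "x \<in> carrier G"
  shows "(M \<inter> N) #> x = (M #> x) \<inter> (N #> x)"
proof (intro subset_antisym subsetI)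
  fix y assume "y \<in> (M #> x) \<inter> (N #> x)"
  then obtain m n where mn: "m \<in> M" "n \<in> N" "y = m \<otimes> x" "y = n \<otimes> x"
    by (auto simp: r_coset_def)
  then have "m = n"
    using assms subgroup.mem_carrier by (metis right_cancel)
  then show "y \<in> (M \<inter> N) #> x"
    using mn by (auto simp: r_coset_def)
qed (auto simp: r_coset_def)

text \<open>A coset of the intersection is the intersection of a coset of \<open>M\<close> and a
  coset of \<open>N\<close>, which leaves finitely many possibilities.\<close>

lemma (in Group.group) finite_index_normal_Int:
  assumes "M \<in> finite_index_normal G" "N \<in> finite_index_normal G"
  shows "M \<inter> N \<in> finite_index_normal G"
proof -
  have MN: "M \<lhd> G" "N \<lhd> G" "finite (carrier (G Mod M))" "finite (carrier (G Mod N))"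
    using assms by (auto simp: finite_index_normal_def)
  then have sub: "subgroup M G" "subgroup N G"
    by (auto simp: normal_inv_iff)
  have "M \<inter> N \<lhd> G"
    using MN(1,2) subgroups_Inter_pair[OF sub] by (auto simp: normal_inv_iff)
  moreover have "carrier (G Mod (M \<inter> N)) \<subseteq>
      (\<lambda>(A, B). A \<inter> B) ` (carrier (G Mod M) \<times> carrier (G Mod N))"
    using r_coset_Int[OF sub] by (auto simp: carrier_FactGroup)
  then have "finite (carrier (G Mod (M \<inter> N)))"
    by (rule finite_subset) (intro finite_imageI finite_cartesian_product MN(3,4))
  ultimately show ?thesis
    by (simp add: finite_index_normal_def)
qed

lemma (in Group.group) finite_index_normal_lower_bound:
  assumes "finite F" "F \<subseteq> finite_index_normal G"
  shows "\<exists>M\<in>finite_index_normal G. \<forall>N\<in>F. M \<subseteq> N"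
  using assms
proof (induction F)
  case empty
  then show ?case
    using carrier_finite_index_normal by blast
next
  case (insert N F)
  then obtain M where "M \<in> finite_index_normal G" "\<forall>N\<in>F. M \<subseteq> N"
    by auto
  then show ?case
    using insert.prems finite_index_normal_Int[of M N] by (intro bexI[of _ "M \<inter> N"]) auto
qed

lemma (in Group.group) carrier_FactGroup_eqI:
  assumes "subgroup N G" "A \<in> carrier (G Mod N)" "B \<in> carrier (G Mod N)" "z \<in> A" "z \<in> B"
  shows "A = B"
proof -
  obtain a b where "A = N #> a" "B = N #> b" "a \<in> carrier G" "b \<in> carrier G"
    using assms(2,3) by (auto simp: carrier_FactGroup)
  then show ?thesis
    using repr_independence[of z N a] repr_independence[of z N b] assms(1,4,5) by simp
qed

lemma (in Group.group) carrier_FactGroup_nonempty: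
  assumes "subgroup N G" "A \<in> carrier (G Mod N)"
  shows "A \<noteq> {}"
  using assms rcos_self by (force simp: carrier_FactGroup)

section \<open>Topology of the profinite completion\<close>

lemma profinite_completion_mem:
  "x \<in> carrier (profinite_completion G) \<Longrightarrow> N \<in> finite_index_normal G \<Longrightarrow> x N \<in> carrier (G Mod N)"
  by (auto simp: profinite_completion_def)

lemma profinite_completion_mult:
  "N \<in> finite_index_normal G \<Longrightarrow>
     (x \<otimes>\<^bsub>profinite_completion G\<^esub> y) N = x N \<otimes>\<^bsub>G Mod N\<^esub> y N"
  by (simp add: profinite_completion_def)

lemma group_FactGroup_finite_index:
  "N \<in> finite_index_normal G \<Longrightarrow> Group.group (G Mod N)"
  by (simp add: finite_index_normal_def normal.factorgroup_is_group)

lemma finite_FactGroup_finite_index: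
  "N \<in> finite_index_normal G \<Longrightarrow> finite (carrier (G Mod N))"
  by (simp add: finite_index_normal_def)

lemma finite_index_normal_subgroup:
  "N \<in> finite_index_normal G \<Longrightarrow> subgroup N G"
  by (simp add: finite_index_normal_def normal_imp_subgroup)

lemma openin_profinite_completion_fibre:
  assumes "N \<in> finite_index_normal G"
  shows "openin (profinite_completion_topology G) {x \<in> carrier (profinite_completion G). x N \<in> A}"
proof -
  let ?X = "product_topology (\<lambda>N. discrete_topology (carrier (G Mod N))) (finite_index_normal G)"
  have "continuous_map ?X (discrete_topology (carrier (G Mod N))) (\<lambda>x. x N)"
    using assms by (rule continuous_map_product_projection)
  then have "openin ?X {x \<in> topspace ?X. x N \<in> A \<inter> carrier (G Mod N)}"
    by (rule openin_continuous_map_preimage) simp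
  then have "openin (profinite_completion_topology G)
      ({x \<in> topspace ?X. x N \<in> A \<inter> carrier (G Mod N)} \<inter> carrier (profinite_completion G))"
    unfolding profinite_completion_topology_def by (rule openin_subtopology_Int)
  also have "{x \<in> topspace ?X. x N \<in> A \<inter> carrier (G Mod N)} \<inter> carrier (profinite_completion G)
      = {x \<in> carrier (profinite_completion G). x N \<in> A}"
    using assms by (auto simp: profinite_completion_def)
  finally show ?thesis .
qed

lemma compact_space_profinite_completion_topology:
  "compact_space (profinite_completion_topology G)"
proof -
  let ?I = "finite_index_normal G"
  let ?D = "\<lambda>N. discrete_topology (carrier (G Mod N))"
  let ?X = "product_topology ?D ?I"
  have X: "compact_space ?X"
    by (simp add: compact_space_product_topology compact_space_discrete_topology
        finite_FactGroup_finite_index)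
  have fib: "openin ?X {x \<in> topspace ?X. x M = A}" if M: "M \<in> ?I" for M A
  proof -
    have "openin ?X {x \<in> topspace ?X. x M \<in> {A} \<inter> carrier (G Mod M)}"
      by (rule openin_continuous_map_preimage[OF continuous_map_product_projection]) (use M in simp_all)
    also have "{x \<in> topspace ?X. x M \<in> {A} \<inter> carrier (G Mod M)} = {x \<in> topspace ?X. x M = A}"
      using M by (auto simp: PiE_iff)
    finally show ?thesis .
  qed
  \<comment> \<open>A violation of compatibility is visible at two coordinates and is therefore an
    open condition; the completion is closed in a product of finite discrete spaces.\<close>
  have "openin ?X (topspace ?X - carrier (profinite_completion G))"
  proof (subst openin_subopen, intro ballI)
    fix x assume x: "x \<in> topspace ?X - carrier (profinite_completion G)"
    then obtain M N where MN: "M \<in> ?I" "N \<in> ?I" "M \<subseteq> N" "\<not> x M \<subseteq> x N"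
      by (auto simp: profinite_completion_def)
    have "openin ?X ({y \<in> topspace ?X. y M = x M} \<inter> {y \<in> topspace ?X. y N = x N})"
      using fib MN(1,2) by blast
    moreover have "{y \<in> topspace ?X. y M = x M} \<inter> {y \<in> topspace ?X. y N = x N}
        \<subseteq> topspace ?X - carrier (profinite_completion G)"
    proof
      fix y assume "y \<in> {y \<in> topspace ?X. y M = x M} \<inter> {y \<in> topspace ?X. y N = x N}"
      then have "y \<in> topspace ?X" "\<not> y M \<subseteq> y N"
        using MN(4) by auto
      then show "y \<in> topspace ?X - carrier (profinite_completion G)"
        using MN(1-3) unfolding profinite_completion_def by simp blast
    qed
    ultimately show "\<exists>V. openin ?X V \<and> x \<in> V \<and> V \<subseteq> topspace ?X - carrier (profinite_completion G)"
      using x by blast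
  qed
  moreover have "carrier (profinite_completion G) \<subseteq> topspace ?X"
    by (auto simp: profinite_completion_def)
  ultimately have "closedin ?X (carrier (profinite_completion G))"
    by (simp add: closedin_def)
  then show ?thesis
    unfolding profinite_completion_topology_def
    using X closedin_compact_space compact_space_subtopology by blast
qed

text \<open>A basic open set restricts finitely many coordinates. A common lower bound
  \<open>M\<close> of these determines all of them: by compatibility the coset at \<open>M\<close>
  lies in the coset at each larger \<open>N\<close>, and two cosets of \<open>N\<close> that meet
  are equal.\<close>

lemma (in Group.group) profinite_completion_nhds:
  assumes U: "openin (profinite_completion_topology G) U" "x \<in> U"
  obtains M where "M \<in> finite_index_normal G"
    "\<And>y. y \<in> carrier (profinite_completion G) \<Longrightarrow> y M = x M \<Longrightarrow> y \<in> U"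
proof -
  let ?I = "finite_index_normal G" and ?P = "profinite_completion G"
  let ?D = "\<lambda>N. discrete_topology (carrier (G Mod N))"
  obtain V where V: "openin (product_topology ?D ?I) V" "U = V \<inter> carrier ?P"
    using U(1) by (auto simp: profinite_completion_topology_def openin_subtopology)
  then have "x \<in> V" "x \<in> carrier ?P"
    using U(2) by auto
  then obtain W where W: "finite {i \<in> ?I. W i \<noteq> topspace (?D i)}" "x \<in> Pi\<^sub>E ?I W" "Pi\<^sub>E ?I W \<subseteq> V"
    using V(1) unfolding openin_product_topology_alt by meson
  obtain M where M: "M \<in> ?I" "\<And>N. N \<in> ?I \<Longrightarrow> W N \<noteq> topspace (?D N) \<Longrightarrow> M \<subseteq> N"
    using finite_index_normal_lower_bound[OF W(1)] by blast
  show thesis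
  proof (rule that[OF M(1)])
    fix y assume y: "y \<in> carrier ?P" "y M = x M"
    have "y N \<in> W N" if N: "N \<in> ?I" for N
    proof (cases "W N = topspace (?D N)")
      case True
      then show ?thesis
        using profinite_completion_mem[OF y(1) N] by simp
    next
      case False
      then have "y M \<subseteq> y N" "x M \<subseteq> x N"
        using M N y(1) \<open>x \<in> carrier ?P\<close> by (auto simp: profinite_completion_def)
      moreover have "y M \<noteq> {}"
        using carrier_FactGroup_nonempty[OF finite_index_normal_subgroup[OF M(1)]]
          profinite_completion_mem[OF y(1) M(1)] by blast
      ultimately obtain z where "z \<in> y N" "z \<in> x N"
        using y(2) by blast
      then have "y N = x N"
        using N y(1) \<open>x \<in> carrier ?P\<close>
        by (intro carrier_FactGroup_eqI[of N] finite_index_normal_subgroup profinite_completion_mem)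
      then show ?thesis
        using W(2) N by (auto simp: PiE_iff)
    qed
    moreover have "y \<in> extensional ?I"
      using y(1) by (simp add: profinite_completion_def PiE_iff)
    ultimately have "y \<in> Pi\<^sub>E ?I W"
      by (simp add: PiE_iff)
    then show "y \<in> U"
      using V(2) W(3) y(1) by blast
  qed
qed

definition to_profinite_completion :: "('a, 'b) monoid_scheme \<Rightarrow> 'a \<Rightarrow> 'a set \<Rightarrow> 'a set" where
  "to_profinite_completion G w = (\<lambda>N\<in>finite_index_normal G. N #>\<^bsub>G\<^esub> w)"

lemma (in Group.group) to_profinite_completion_hom:
  "to_profinite_completion G \<in> hom G (profinite_completion G)"
proof (rule homI)
  fix w assume w: "w \<in> carrier G"
  then show "to_profinite_completion G w \<in> carrier (profinite_completion G)"
    by (fastforce simp: to_profinite_completion_def profinite_completion_def carrier_FactGroup r_coset_def)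
  fix v assume v: "v \<in> carrier G"
  have "N #> (w \<otimes> v) = (N #> w) <#> (N #> v)" if "N \<in> finite_index_normal G" for N
    using that w v by (simp add: finite_index_normal_def normal.rcos_sum)
  then show "to_profinite_completion G (w \<otimes> v) =
      to_profinite_completion G w \<otimes>\<^bsub>profinite_completion G\<^esub> to_profinite_completion G v"
    by (simp add: to_profinite_completion_def profinite_completion_def cong: restrict_cong)
qed

text \<open>One coordinate \<open>M\<close> is enough to enter \<open>U\<close>, and the coset found
  there has a representative in \<open>G\<close>.\<close>

lemma (in Group.group) to_profinite_completion_dense:
  assumes "openin (profinite_completion_topology G) U" "U \<noteq> {}"
  obtains w where "w \<in> carrier G" "to_profinite_completion G w \<in> U"
proof -
  obtain x where x: "x \<in> U"
    using assms(2) by blast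
  then have xP: "x \<in> carrier (profinite_completion G)"
    using openin_subset[OF assms(1)] by auto
  obtain M where M: "M \<in> finite_index_normal G"
    "\<And>y. y \<in> carrier (profinite_completion G) \<Longrightarrow> y M = x M \<Longrightarrow> y \<in> U"
    using profinite_completion_nhds[OF assms(1) x] by blast
  obtain w where w: "w \<in> carrier G" "x M = M #> w"
    using profinite_completion_mem[OF xP M(1)] by (auto simp: carrier_FactGroup)
  have "to_profinite_completion G w \<in> carrier (profinite_completion G)"
    using to_profinite_completion_hom w(1) by (auto simp: hom_def)
  then have "to_profinite_completion G w \<in> U"
    using M w(2) by (simp add: to_profinite_completion_def)
  with w(1) show thesis
    by (rule that)
qed

section \<open>Quotients by closed normal subgroups\<close>

lemma openin_FactGroup_topology:
  assumes "topspace T = carrier G"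
  shows "openin (FactGroup_topology G T R) U \<longleftrightarrow>
    U \<subseteq> carrier (G Mod R) \<and> openin T {x \<in> carrier G. R #>\<^bsub>G\<^esub> x \<in> U}"
  using assms by (simp add: FactGroup_topology_def openin_quotient_topology carrier_FactGroup)

lemma topspace_FactGroup_topology:
  assumes "topspace T = carrier G"
  shows "topspace (FactGroup_topology G T R) = carrier (G Mod R)"
  using assms by (simp add: FactGroup_topology_def carrier_FactGroup)

lemma compact_space_FactGroup_topology:
  assumes "compact_space T"
  shows "compact_space (FactGroup_topology G T R)"
proof -
  have "quotient_map T (FactGroup_topology G T R) (\<lambda>x. R #>\<^bsub>G\<^esub> x)"
    unfolding FactGroup_topology_def by (rule quotient_map_quotient_topology)
  then show ?thesis
    using assms unfolding compact_space_def
    by (metis image_compactin quotient_imp_continuous_map quotient_imp_surjective_map)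
qed

lemma (in normal) FactGroup_mult_rcosets:
  assumes "x \<in> carrier G" "y \<in> carrier G"
  shows "(H #> x) \<otimes>\<^bsub>G Mod H\<^esub> (H #> y) = H #> (x \<otimes> y)"
  using assms rcos_sum by simp

text \<open>Quotient maps of \<open>G Mod R\<close> are replaced by maps on \<open>G\<close> that
  are trivial on \<open>R\<close>. The map then makes sense independently of \<open>R\<close>, so
  one and the same map can be tested against different subgroups.\<close>

lemma has_quotient_table_FactGroup:
  assumes "R \<lhd> G" and T: "topspace T = carrier G"
  shows "has_quotient_table (G Mod R) (FactGroup_topology G T R) c \<longleftrightarrow>
    (\<exists>f. f ` carrier G = {..<length c} \<and>
     (\<forall>x\<in>carrier G. \<forall>y\<in>carrier G. f (x \<otimes>\<^bsub>G\<^esub> y) = c ! f x ! f y) \<and>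
     (\<forall>i. openin T {x \<in> carrier G. f x = i}) \<and> (\<forall>x\<in>R. f x = f \<one>\<^bsub>G\<^esub>))" (is "_ = ?rhs")
proof
  interpret normal R G by fact
  let ?q = "\<lambda>x. R #>\<^bsub>G\<^esub> x"
  have car: "carrier (G Mod R) = ?q ` carrier G"
    by (rule carrier_FactGroup)
  {
    assume "has_quotient_table (G Mod R) (FactGroup_topology G T R) c"
    then obtain f where f: "f ` carrier (G Mod R) = {..<length c}"
      "\<And>x y. x \<in> carrier (G Mod R) \<Longrightarrow> y \<in> carrier (G Mod R) \<Longrightarrow>
        f (x \<otimes>\<^bsub>G Mod R\<^esub> y) = c ! f x ! f y"
      "\<And>i. openin (FactGroup_topology G T R) {x \<in> carrier (G Mod R). f x = i}"
      unfolding has_quotient_table_def by blast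
    have "(f \<circ> ?q) ` carrier G = {..<length c}"
      using f(1) by (simp add: car image_comp)
    moreover have "(f \<circ> ?q) (x \<otimes>\<^bsub>G\<^esub> y) = c ! (f \<circ> ?q) x ! (f \<circ> ?q) y"
      if "x \<in> carrier G" "y \<in> carrier G" for x y
      using f(2)[of "?q x" "?q y"] that car by (simp add: FactGroup_mult_rcosets del: mult_FactGroup)
    moreover have "openin T {x \<in> carrier G. (f \<circ> ?q) x = i}" for i
    proof -
      have "openin T {x \<in> carrier G. ?q x \<in> {x \<in> carrier (G Mod R). f x = i}}"
        using f(3)[of i] by (simp add: openin_FactGroup_topology[OF T])
      also have "{x \<in> carrier G. ?q x \<in> {x \<in> carrier (G Mod R). f x = i}} =
          {x \<in> carrier G. (f \<circ> ?q) x = i}"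
        by (auto simp: car)
      finally show ?thesis .
    qed
    moreover have "(f \<circ> ?q) x = (f \<circ> ?q) \<one>\<^bsub>G\<^esub>" if "x \<in> R" for x
      using that rcos_const[OF is_group, of x] rcos_const[OF is_group, of "\<one>\<^bsub>G\<^esub>"] by simp
    ultimately show ?rhs
      by blast
  }
  {
    assume ?rhs
    then obtain f where f: "f ` carrier G = {..<length c}"
      "\<And>x y. x \<in> carrier G \<Longrightarrow> y \<in> carrier G \<Longrightarrow> f (x \<otimes>\<^bsub>G\<^esub> y) = c ! f x ! f y"
      "\<And>i. openin T {x \<in> carrier G. f x = i}"
      "\<And>x. x \<in> R \<Longrightarrow> f x = f \<one>\<^bsub>G\<^esub>"
      by blast
    \<comment> \<open>The representative is irrelevant: multiplying by an element of
      \<open>R\<close> on the left does not change \<open>f\<close>, because the table sees it as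
      the unit.\<close>
    define g where "g C = f (SOME x. x \<in> C)" for C
    have g: "g (?q x) = f x" if x: "x \<in> carrier G" for x
    proof -
      have "x \<in> ?q x"
        using x subgroup_axioms rcos_self by blast
      then have "(SOME y. y \<in> ?q x) \<in> ?q x"
        by (rule someI)
      then obtain r where r: "r \<in> R" "(SOME y. y \<in> ?q x) = r \<otimes>\<^bsub>G\<^esub> x"
        by (auto simp: r_coset_def)
      then have "g (?q x) = f (r \<otimes>\<^bsub>G\<^esub> x)"
        by (simp add: g_def)
      also have "\<dots> = f (\<one>\<^bsub>G\<^esub> \<otimes>\<^bsub>G\<^esub> x)"
        using f(2)[of r x] f(2)[of "\<one>\<^bsub>G\<^esub>" x] f(4)[OF r(1)] r(1) x mem_carrier by auto
      finally show ?thesis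
        using x by simp
    qed
    have "g ` carrier (G Mod R) = {..<length c}"
      unfolding f(1)[symmetric] car image_image by (rule image_cong) (simp_all add: g)
    moreover have "g (x \<otimes>\<^bsub>G Mod R\<^esub> y) = c ! g x ! g y"
      if xy: "x \<in> carrier (G Mod R)" "y \<in> carrier (G Mod R)" for x y
    proof -
      obtain a where a: "a \<in> carrier G" "x = ?q a"
        using xy(1) unfolding car by blast
      obtain b where b: "b \<in> carrier G" "y = ?q b"
        using xy(2) unfolding car by blast
      note ab = a(1) b(1) a(2) b(2)
      have "g (x \<otimes>\<^bsub>G Mod R\<^esub> y) = g (?q (a \<otimes>\<^bsub>G\<^esub> b))"
        using ab by (simp add: FactGroup_mult_rcosets del: mult_FactGroup)
      also have "\<dots> = c ! f a ! f b"
        using g[of "a \<otimes>\<^bsub>G\<^esub> b"] f(2) ab(1,2) by simp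
      finally show ?thesis
        using g ab by simp
    qed
    moreover have "openin (FactGroup_topology G T R) {x \<in> carrier (G Mod R). g x = i}" for i
    proof -
      have "{x \<in> carrier G. ?q x \<in> {x \<in> carrier (G Mod R). g x = i}} = {x \<in> carrier G. f x = i}"
        using g by (auto simp: car)
      then show ?thesis
        using f(3)[of i] by (simp add: openin_FactGroup_topology[OF T])
    qed
    ultimately show "has_quotient_table (G Mod R) (FactGroup_topology G T R) c"
      unfolding has_quotient_table_def by blast
  }
qed

text \<open>Precomposition with the projection embeds the maps of the quotient into those of
  \<open>G\<close>.\<close>

lemma finite_finite_quotient_maps_FactGroup:
  assumes "R \<lhd> G" and T: "topspace T = carrier G" and fin: "finite (finite_quotient_maps G T n)"
  shows "finite (finite_quotient_maps (G Mod R) (FactGroup_topology G T R) n)"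
proof -
  interpret normal R G by fact
  let ?q = "\<lambda>x. R #>\<^bsub>G\<^esub> x" and ?M = "finite_quotient_maps (G Mod R) (FactGroup_topology G T R) n"
  have car: "carrier (G Mod R) = ?q ` carrier G"
    by (rule carrier_FactGroup)
  define p where "p f = restrict (f \<circ> ?q) (carrier G)" for f :: "'a set \<Rightarrow> nat"
  have "p f \<in> finite_quotient_maps G T n" if f: "f \<in> ?M" for f
  proof (rule finite_quotient_mapsI)
    show "p f \<in> carrier G \<rightarrow>\<^sub>E {..<n}"
      using finite_quotient_maps_less[OF f] car by (auto simp: p_def)
    show "openin T {x \<in> carrier G. p f x = i}" for i
    proof -
      have "openin T {x \<in> carrier G. ?q x \<in> {x \<in> carrier (G Mod R). f x = i}}"
        using openin_fibre[OF f, of i] by (simp add: openin_FactGroup_topology[OF T])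
      also have "{x \<in> carrier G. ?q x \<in> {x \<in> carrier (G Mod R). f x = i}} = {x \<in> carrier G. p f x = i}"
        by (auto simp: car p_def)
      finally show ?thesis .
    qed
    show "p f (x \<otimes>\<^bsub>G\<^esub> y) = p f (x' \<otimes>\<^bsub>G\<^esub> y')"
      if "x \<in> carrier G" "x' \<in> carrier G" "y \<in> carrier G" "y' \<in> carrier G"
        "p f x = p f x'" "p f y = p f y'" for x x' y y'
    proof -
      have "f (?q x \<otimes>\<^bsub>G Mod R\<^esub> ?q y) = f (?q x' \<otimes>\<^bsub>G Mod R\<^esub> ?q y')"
        by (rule finite_quotient_maps_mult[OF f]) (use that car in \<open>auto simp: p_def\<close>)
      then show ?thesis
        using that by (simp add: p_def FactGroup_mult_rcosets del: mult_FactGroup)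
    qed
  qed
  then have "finite (p ` ?M)"
    using fin by (metis finite_subset image_subsetI)
  moreover have "inj_on p ?M"
  proof (rule inj_onI)
    fix f g assume fg: "f \<in> ?M" "g \<in> ?M" "p f = p g"
    have "f C = g C" if C: "C \<in> carrier (G Mod R)" for C
    proof -
      obtain x where "x \<in> carrier G" "C = ?q x"
        using C car by blast
      then show ?thesis
        using fun_cong[OF fg(3), of x] by (simp add: p_def)
    qed
    then show "f = g"
      by (intro PiE_ext[OF fg(1,2)[THEN finite_quotient_maps_PiE]])
  qed
  ultimately show ?thesis
    by (rule finite_imageD)
qed

lemma (in Group.group) profinite_completion_evaluation_hom:
  assumes "N \<in> finite_index_normal G" "x \<in> carrier (profinite_completion G)" "y \<in> carrier (profinite_completion G)"
  shows "(x \<otimes>\<^bsub>profinite_completion G\<^esub> inv\<^bsub>profinite_completion G\<^esub> y) N = x N \<otimes>\<^bsub>G Mod N\<^esub> inv\<^bsub>G Mod N\<^esub> (y N)"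
proof -
  let ?P = "profinite_completion G"
  interpret P: Group.group ?P
    by (rule group_profinite_completion[OF is_group])
  interpret Q: Group.group "G Mod N"
    by (rule group_FactGroup_finite_index[OF assms(1)])
  have "group_hom ?P (G Mod N) (\<lambda>x. x N)"
    using assms(1) profinite_completion_mem profinite_completion_mult
    by unfold_locales (fastforce simp: hom_def simp del: mult_FactGroup)
  then interpret group_hom ?P "G Mod N" "\<lambda>x. x N" .
  show ?thesis
    using assms(2,3) hom_mult hom_inv by (simp del: mult_FactGroup)
qed

text \<open>Closedness of \<open>R\<close> yields the separation property. For the base of fibres, a
  coset of \<open>R\<close> is observed through its image at a single coordinate \<open>M\<close>, a
  coset of the image of \<open>R\<close> in the finite group \<open>G Mod M\<close>.\<close>

lemma fg_profinite_FactGroup_profinite_completion: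
  assumes "Group.group G" and R: "R \<in> closed_normal_subgroups (profinite_completion G) (profinite_completion_topology G)"
    and fin: "\<And>n. finite (finite_quotient_maps (profinite_completion G) (profinite_completion_topology G) n)"
  shows "fg_profinite (profinite_completion G Mod R)
    (FactGroup_topology (profinite_completion G) (profinite_completion_topology G) R)"
proof -
  let ?P = "profinite_completion G" and ?T = "profinite_completion_topology G"
  let ?I = "finite_index_normal G"
  interpret G: Group.group G by fact
  have R': "R \<lhd> ?P" "closedin ?T R"
    using R by (auto simp: closed_normal_subgroups_def)
  interpret R: normal R ?P by fact
  let ?q = "\<lambda>x. R #>\<^bsub>?P\<^esub> x" and ?Q = "?P Mod R" and ?S = "FactGroup_topology ?P ?T R"
  have T: "topspace ?T = carrier ?P"
    by simp
  have car: "carrier ?Q = ?q ` carrier ?P"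
    by (rule carrier_FactGroup)
  have t1: "t1_space ?S"
    unfolding t1_space_closedin_singleton topspace_FactGroup_topology[OF T]
  proof
    fix C assume "C \<in> carrier ?Q"
    then obtain y where y: "y \<in> carrier ?P" "C = ?q y"
      using car by blast
    have "openin ?T {x \<in> carrier ?P. ?q x \<in> carrier ?Q - {C}}"
    proof (subst openin_subopen, intro ballI)
      fix x assume "x \<in> {x \<in> carrier ?P. ?q x \<in> carrier ?Q - {C}}"
      then have x: "x \<in> carrier ?P" "?q x \<noteq> C"
        by auto
      \<comment> \<open>A neighbourhood of \<open>?z\<close> missing \<open>R\<close> is determined
        by the coordinate \<open>M\<close>. If \<open>v\<close> agrees with \<open>x\<close> there,
        then \<open>v\<close> times the inverse of \<open>y\<close> agrees with \<open>?z\<close>,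
        so \<open>v\<close> is not in the coset of \<open>y\<close>.\<close>
      let ?z = "x \<otimes>\<^bsub>?P\<^esub> inv\<^bsub>?P\<^esub> y"
      have "?z \<notin> R"
      proof
        assume "?z \<in> R"
        then have "?z \<otimes>\<^bsub>?P\<^esub> y \<in> ?q y"
          by (auto simp: r_coset_def)
        then have "x \<in> ?q y"
          using x(1) y(1) by (simp add: R.m_assoc)
        then show False
          using R.repr_independence[of x R y] x(2) y R.subgroup_axioms by simp
      qed
      then have "?z \<in> topspace ?T - R"
        using x(1) y(1) by simp
      moreover have "openin ?T (topspace ?T - R)"
        using R'(2) by blast
      ultimately obtain M where M: "M \<in> ?I" "\<And>v. v \<in> carrier ?P \<Longrightarrow> v M = ?z M \<Longrightarrow> v \<notin> R"
        using G.profinite_completion_nhds by (metis DiffD2)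
      have "?q v \<noteq> C" if v: "v \<in> carrier ?P" "v M = x M" for v
      proof
        assume "?q v = C"
        then have "v \<in> ?q y"
          using y v R.rcos_self R.subgroup_axioms by blast
        then obtain r where r: "r \<in> R" "v = r \<otimes>\<^bsub>?P\<^esub> y"
          by (auto simp: r_coset_def)
        then have "v \<otimes>\<^bsub>?P\<^esub> inv\<^bsub>?P\<^esub> y = r"
          using y(1) by (simp add: R.m_assoc R.mem_carrier)
        moreover have "(v \<otimes>\<^bsub>?P\<^esub> inv\<^bsub>?P\<^esub> y) M = ?z M"
          using G.profinite_completion_evaluation_hom[OF M(1)] v x(1) y(1) by simp
        ultimately show False
          using M(2)[of r] r(1) R.mem_carrier by auto
      qed
      then show "\<exists>V. openin ?T V \<and> x \<in> V \<and> V \<subseteq> {x \<in> carrier ?P. ?q x \<in> carrier ?Q - {C}}"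
        using x(1) car openin_profinite_completion_fibre[OF M(1), of "{x M}"]
        by (intro exI[of _ "{v \<in> carrier ?P. v M \<in> {x M}}"]) auto
    qed
    then have "openin ?S (carrier ?Q - {C})"
      by (simp add: openin_FactGroup_topology[OF T])
    then show "closedin ?S {C}"
      using \<open>C \<in> carrier ?Q\<close> by (simp add: closedin_def topspace_FactGroup_topology[OF T])
  qed
  have base: "\<exists>n. \<exists>f\<in>finite_quotient_maps ?Q ?S n. \<forall>D\<in>carrier ?Q. f D = f C \<longrightarrow> D \<in> U"
    if U: "openin ?S U" "C \<in> U" for U C
  proof -
    have U': "U \<subseteq> carrier ?Q" "openin ?T {x \<in> carrier ?P. ?q x \<in> U}"
      using U(1) by (auto simp: openin_FactGroup_topology[OF T])
    then obtain x where x: "x \<in> carrier ?P" "C = ?q x"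
      using U(2) car by blast
    then have "x \<in> {x \<in> carrier ?P. ?q x \<in> U}"
      using U(2) by simp
    then obtain M where M: "M \<in> ?I" "\<And>y. y \<in> carrier ?P \<Longrightarrow> y M = x M \<Longrightarrow> ?q y \<in> U"
      using G.profinite_completion_nhds[OF U'(2)] by (metis (mono_tags, lifting) mem_Collect_eq)
    \<comment> \<open>The images at \<open>M\<close> are subsets of a finite group; \<open>e\<close>
      numbers all subsets, which avoids forming a further quotient group.\<close>
    have "finite (Pow (carrier (G Mod M)))"
      using finite_FactGroup_finite_index[OF M(1)] by simp
    then obtain e where e: "bij_betw e (Pow (carrier (G Mod M))) {0..<card (Pow (carrier (G Mod M)))}"
      using ex_bij_betw_finite_nat by blast
    let ?n = "card (Pow (carrier (G Mod M)))"
    let ?ev = "\<lambda>D. (\<lambda>y. y M) ` D"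
    define f where "f = restrict (\<lambda>D. e (?ev D)) (carrier ?Q)"
    have sub: "D \<subseteq> carrier ?P" if "D \<in> carrier ?Q" for D
      using that car R.r_coset_subset_G[OF R.subset] by auto
    have ev: "?ev D \<in> Pow (carrier (G Mod M))" if "D \<in> carrier ?Q" for D
      using sub[OF that] profinite_completion_mem[OF _ M(1)] by auto
    have f_eq: "f D = f D' \<longleftrightarrow> ?ev D = ?ev D'" if "D \<in> carrier ?Q" "D' \<in> carrier ?Q" for D D'
      using that ev inj_on_eq_iff[OF bij_betw_imp_inj_on[OF e], of "?ev D" "?ev D'"] by (simp add: f_def)
    have ev_mult: "?ev (D \<otimes>\<^bsub>?Q\<^esub> D') = ?ev D <#>\<^bsub>G Mod M\<^esub> ?ev D'"
      if "D \<in> carrier ?Q" "D' \<in> carrier ?Q" for D D'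
      by (simp only: mult_FactGroup[of ?P R] set_mult_def image_UN image_insert image_empty
          profinite_completion_mult[OF M(1)] UN_simps)
    have f: "f \<in> finite_quotient_maps ?Q ?S ?n"
    proof (rule finite_quotient_mapsI)
      show "f \<in> carrier ?Q \<rightarrow>\<^sub>E {..<?n}"
        using ev e by (auto simp: f_def bij_betw_def lessThan_atLeast0)
      show "f (D \<otimes>\<^bsub>?Q\<^esub> E) = f (D' \<otimes>\<^bsub>?Q\<^esub> E')"
        if "D \<in> carrier ?Q" "D' \<in> carrier ?Q" "E \<in> carrier ?Q" "E' \<in> carrier ?Q"
          "f D = f D'" "f E = f E'" for D D' E E'
      proof -
        have "D \<otimes>\<^bsub>?Q\<^esub> E \<in> carrier ?Q" "D' \<otimes>\<^bsub>?Q\<^esub> E' \<in> carrier ?Q"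
          using that R.factorgroup_is_group by (meson group.is_monoid monoid.m_closed)+
        then show ?thesis
          using that ev_mult[of D E] ev_mult[of D' E'] by (simp only: f_eq)
      qed
      \<comment> \<open>The image of the coset of \<open>v\<close> depends only on the coordinate
        \<open>v M\<close>, so the fibres of \<open>f\<close> have open preimages.\<close>
      have ev_q: "?ev (?q v) = ?ev R #>\<^bsub>G Mod M\<^esub> v M" for v
        by (simp only: r_coset_def image_UN image_insert image_empty
            profinite_completion_mult[OF M(1)] UN_simps)
      show "openin ?S {D \<in> carrier ?Q. f D = i}" for i
      proof -
        have "{v \<in> carrier ?P. ?q v \<in> {D \<in> carrier ?Q. f D = i}} =
            {v \<in> carrier ?P. v M \<in> {a. e (?ev R #>\<^bsub>G Mod M\<^esub> a) = i}}"
          using car ev_q by (auto simp: f_def)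
        then show ?thesis
          using openin_profinite_completion_fibre[OF M(1), of "{a. e (?ev R #>\<^bsub>G Mod M\<^esub> a) = i}"]
          by (simp add: openin_FactGroup_topology[OF T])
      qed
    qed
    have "D \<in> U" if D: "D \<in> carrier ?Q" "f D = f C" for D
    proof -
      obtain y where y: "y \<in> carrier ?P" "D = ?q y"
        using D(1) car by blast
      \<comment> \<open>The equal images give a representative \<open>v\<close> of \<open>D\<close>
        with the same coordinate at \<open>M\<close> as \<open>x\<close>, and the choice of
        \<open>M\<close> puts its coset into \<open>U\<close>.\<close>
      have "x M \<in> ?ev C"
        using x R.rcos_self R.subgroup_axioms by blast
      then have "x M \<in> ?ev D"
        using D f_eq[of D C] U(2) U'(1) by blast
      then obtain v where v: "v \<in> ?q y" "x M = v M"
        using y by blast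
      then have "?q v = D" "v \<in> carrier ?P"
        using y R.repr_independence[of v R y] R.subgroup_axioms D(1) sub by auto
      then show ?thesis
        using M(2)[of v] v(2) by simp
    qed
    then show ?thesis
      using f by blast
  qed
  show ?thesis
  proof (intro fg_profinite.intro fg_profinite_axioms.intro)
    show "Group.group ?Q"
      by (rule R.factorgroup_is_group)
    show "topspace ?S = carrier ?Q"
      by (rule topspace_FactGroup_topology[OF T])
    show "compact_space ?S"
      by (rule compact_space_FactGroup_topology[OF compact_space_profinite_completion_topology])
    show "finite (finite_quotient_maps ?Q ?S n)" for n
      by (rule finite_finite_quotient_maps_FactGroup[OF R'(1) T fin])
  qed (fact t1, fact base)
qed

section \<open>Finiteness of the quotient maps of a free profinite group\<close>

lemma free_group_letter:
  "l \<in> A \<times> UNIV \<Longrightarrow> [l] \<in> carrier (free_group A)"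
  by (auto simp: free_group_def)

lemma free_group_ConsD:
  assumes "l # w \<in> carrier (free_group A)"
  shows "l \<in> A \<times> UNIV" "w \<in> carrier (free_group A)" "[l] \<otimes>\<^bsub>free_group A\<^esub> w = l # w"
proof -
  show "l \<in> A \<times> UNIV" "w \<in> carrier (free_group A)"
    using assms by (auto simp: free_group_def reduced_Cons mem_Times_iff)
  show "[l] \<otimes>\<^bsub>free_group A\<^esub> w = l # w"
    using assms by (cases w) (auto simp: free_group_def)
qed

text \<open>A map is determined by the operation it induces and by its values on the empty word and
  the signed letters: these give its values on all words by induction, and the words are dense. Only
  finitely many such data exist below \<open>n\<close>.\<close>

lemma finite_finite_quotient_maps_free_profinite:
  "finite (finite_quotient_maps (free_profinite k) (free_profinite_topology k) n)" (is "finite ?M")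
proof -
  let ?F = "free_group {..<k}" and ?P = "free_profinite k" and ?T = "free_profinite_topology k"
  interpret F: Group.group ?F
    by (rule group_free_group)
  interpret P: Group.group ?P
    unfolding free_profinite_def by (rule group_profinite_completion[OF F.is_group])
  let ?i = "to_profinite_completion ?F" and ?L = "{..<k} \<times> (UNIV :: bool set)"
  have i: "?i \<in> hom ?F ?P"
    unfolding free_profinite_def by (rule F.to_profinite_completion_hom)
  then interpret i: group_hom ?F ?P ?i
    by unfold_locales
  \<comment> \<open>The graph of the induced operation. Letters of both signs enter
    \<open>?L\<close>, so the induction on words uses products only.\<close>
  define D where "D f = {(f x, f y, f (x \<otimes>\<^bsub>?P\<^esub> y)) | x y. x \<in> carrier ?P \<and> y \<in> carrier ?P}"
    for f :: "free_profinite_elem \<Rightarrow> nat"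
  define key where "key f = (D f, restrict (\<lambda>l. f (?i [l])) ?L, f (?i []))"
    for f :: "free_profinite_elem \<Rightarrow> nat"
  have i_mem: "?i w \<in> carrier ?P" if "w \<in> carrier ?F" for w
    using that by simp
  have Nil: "[] \<in> carrier ?F"
    by (simp add: free_group_def)
  have "key ` ?M \<subseteq> Pow ({..<n} \<times> {..<n} \<times> {..<n}) \<times> (?L \<rightarrow>\<^sub>E {..<n}) \<times> {..<n}"
  proof (rule image_subsetI)
    fix f assume f: "f \<in> ?M"
    note less = finite_quotient_maps_less[OF f]
    have "D f \<subseteq> {..<n} \<times> {..<n} \<times> {..<n}"
      by (auto simp: D_def less)
    moreover have "restrict (\<lambda>l. f (?i [l])) ?L \<in> ?L \<rightarrow>\<^sub>E {..<n}"
      using less[OF i_mem[OF free_group_letter]] by (auto simp: Pi_iff)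
    ultimately show "key f \<in> Pow ({..<n} \<times> {..<n} \<times> {..<n}) \<times> (?L \<rightarrow>\<^sub>E {..<n}) \<times> {..<n}"
      using less[OF i_mem[OF Nil]] by (simp add: key_def)
  qed
  then have "finite (key ` ?M)"
    by (rule finite_subset) (intro finite_cartesian_product finite_PiE finite_Pow_iff[THEN iffD2]; simp)
  moreover have "inj_on key ?M"
  proof (rule inj_onI)
    fix f g assume f: "f \<in> ?M" and g: "g \<in> ?M" and key: "key f = key g"
    then have D: "D f = D g" and Nil_eq: "f (?i []) = g (?i [])"
      by (simp_all add: key_def)
    have letter: "f (?i [l]) = g (?i [l])" if "l \<in> ?L" for l
    proof -
      have "restrict (\<lambda>l. f (?i [l])) ?L = restrict (\<lambda>l. g (?i [l])) ?L"
        using key by (simp add: key_def)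
      from fun_cong[OF this, of l] show ?thesis
        using that by simp
    qed
    have word: "f (?i w) = g (?i w)" if "w \<in> carrier ?F" for w
      using that
    proof (induction w)
      case Nil
      show ?case by (rule Nil_eq)
    next
      case (Cons l w)
      note l = free_group_ConsD[OF Cons.prems]
      have li: "?i [l] \<in> carrier ?P" "?i w \<in> carrier ?P"
        by (rule i_mem[OF free_group_letter[OF l(1)]], rule i_mem[OF l(2)])
      have eq: "?i (l # w) = ?i [l] \<otimes>\<^bsub>?P\<^esub> ?i w"
        using i.hom_mult[OF free_group_letter[OF l(1)] l(2)] l(3) by simp
      have "(f (?i [l]), f (?i w), f (?i [l] \<otimes>\<^bsub>?P\<^esub> ?i w)) \<in> D f"
        using li by (auto simp: D_def)
      then obtain x y where xy: "x \<in> carrier ?P" "y \<in> carrier ?P" "g x = f (?i [l])" "g y = f (?i w)"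
        "g (x \<otimes>\<^bsub>?P\<^esub> y) = f (?i [l] \<otimes>\<^bsub>?P\<^esub> ?i w)"
        unfolding D by (auto simp: D_def)
      have "g (x \<otimes>\<^bsub>?P\<^esub> y) = g (?i [l] \<otimes>\<^bsub>?P\<^esub> ?i w)"
        using xy(1-4) li letter[OF l(1)] Cons.IH[OF l(2)] by (intro finite_quotient_maps_mult[OF g]) auto
      then show ?case
        using xy(5) eq by simp
    qed
    \<comment> \<open>The fibres of \<open>f\<close> and \<open>g\<close> through \<open>x\<close>
      are open, so their intersection contains a word.\<close>
    have "f x = g x" if x: "x \<in> carrier ?P" for x
    proof -
      have "openin ?T ({y \<in> carrier ?P. f y = f x} \<inter> {y \<in> carrier ?P. g y = g x})"
        using openin_fibre[OF f] openin_fibre[OF g] by blast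
      moreover have "{y \<in> carrier ?P. f y = f x} \<inter> {y \<in> carrier ?P. g y = g x} \<noteq> {}"
        using x by blast
      ultimately obtain w where "w \<in> carrier ?F"
        "?i w \<in> {y \<in> carrier ?P. f y = f x} \<inter> {y \<in> carrier ?P. g y = g x}"
        using F.to_profinite_completion_dense unfolding free_profinite_topology_def by blast
      then show ?thesis
        using word[of w] by simp
    qed
    then show "f = g"
      by (intro PiE_ext[OF finite_quotient_maps_PiE[OF f] finite_quotient_maps_PiE[OF g]])
  qed
  ultimately show ?thesis
    by (rule finite_imageD)
qed

lemma fg_profinite_FactGroup_free_profinite:
  assumes "R \<in> closed_normal_subgroups (free_profinite k) (free_profinite_topology k)"
  shows "fg_profinite (free_profinite k Mod R)
    (FactGroup_topology (free_profinite k) (free_profinite_topology k) R)"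
  using fg_profinite_FactGroup_profinite_completion[OF group_free_group, of R "{..<k}"] assms
    finite_finite_quotient_maps_free_profinite
  by (simp add: free_profinite_def free_profinite_topology_def)

section \<open>The invariant is Borel\<close>

text \<open>With ratio 1/3 all terms after the first difference sum to at most half of the deciding
  term. Ratio 1/2 would allow equality, as for the two binary expansions of a dyadic number.\<close>

lemma ternary_expansion_inj:
  "inj (\<lambda>A::nat set. \<Sum>n. if n \<in> A then (1 / 3 :: real) ^ n else 0)"
proof -
  define t where "t A n = (if n \<in> A then (1 / 3 :: real) ^ n else 0)" for A :: "nat set" and n
  have geo: "summable (\<lambda>k. (1 / 3 :: real) ^ k)"
    by (rule summable_geometric) simp
  have sm: "summable (t A)" for A
    by (rule summable_comparison_test'[OF geo, of 0]) (auto simp: t_def)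
  have less: "suminf (t B) < suminf (t A)"
    if n: "n \<in> A" "n \<notin> B" "\<And>i. i < n \<Longrightarrow> i \<in> A \<longleftrightarrow> i \<in> B" for A B n
  proof -
    have split: "suminf (t C) = (\<Sum>k. t C (k + Suc n)) + t C n + (\<Sum>i<n. t C i)" for C
      using suminf_split_initial_segment[OF sm, of C "Suc n"] by simp
    have "(\<Sum>k. t B (k + Suc n)) \<le> (\<Sum>k. (1 / 3) ^ Suc n * (1 / 3) ^ k)"
    proof (rule suminf_le)
      show "t B (k + Suc n) \<le> (1 / 3) ^ Suc n * (1 / 3) ^ k" for k
        by (simp add: t_def power_add)
    qed (use sm geo in \<open>intro summable_mult summable_ignore_initial_segment; blast\<close>)+
    also have "\<dots> = (1 / 3) ^ Suc n * (3 / 2)"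
      by (subst suminf_mult[OF geo]) (simp add: suminf_geometric)
    also have "\<dots> < (1 / 3) ^ n"
      by simp
    finally have "(\<Sum>k. t B (k + Suc n)) < t A n"
      using n(1) by (simp add: t_def)
    moreover have "0 \<le> (\<Sum>k. t A (k + Suc n))"
      using summable_ignore_initial_segment[OF sm] by (rule suminf_nonneg) (simp add: t_def)
    moreover have "(\<Sum>i<n. t A i) = (\<Sum>i<n. t B i)"
      using n(3) by (intro sum.cong) (auto simp: t_def)
    moreover have "t B n = 0"
      using n(2) by (simp add: t_def)
    ultimately show ?thesis
      unfolding split by linarith
  qed
  have "suminf (t A) \<noteq> suminf (t B)" if "A \<noteq> B" for A B
  proof -
    define n where "n = (LEAST n. n \<in> A \<longleftrightarrow> n \<notin> B)"
    have "\<exists>n. n \<in> A \<longleftrightarrow> n \<notin> B"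
      using that by blast
    then have "n \<in> A \<longleftrightarrow> n \<notin> B" "\<And>i. i < n \<Longrightarrow> i \<in> A \<longleftrightarrow> i \<in> B"
      unfolding n_def by (rule LeastI_ex) (use not_less_Least in blast)
    then show ?thesis
      using less[of n A B] less[of n B A] by (cases "n \<in> A") auto
  qed
  then show ?thesis
    unfolding inj_def t_def by blast
qed

section \<open>The Hausdorff metric on closed normal subgroups\<close>

locale compact_biinvariant_group = Group.group G for G (structure) +
  fixes T \<delta>
  assumes compact: "compact_space T"
    and metric: "compatible_biinvariant_metric G T \<delta>"
begin

sublocale \<delta>: Metric_space "carrier G" \<delta>
  using metric by (simp add: compatible_biinvariant_metric_def)

lemma mtopology_eq: "\<delta>.mtopology = T"
  using metric by (simp add: compatible_biinvariant_metric_def)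

lemma topspace_eq: "topspace T = carrier G"
  using \<delta>.topspace_mtopology by (simp add: mtopology_eq)

lemma right_invariant:
  "x \<in> carrier G \<Longrightarrow> y \<in> carrier G \<Longrightarrow> g \<in> carrier G \<Longrightarrow> \<delta> (x \<otimes> g) (y \<otimes> g) = \<delta> x y"
  using metric by (simp add: compatible_biinvariant_metric_def)

abbreviation "\<K> \<equiv> closed_normal_subgroups G T"
abbreviation "\<H> \<equiv> Hausdorff_metric \<K> \<delta>"

lemma closed_normal_subgroupsD:
  assumes "A \<in> \<K>"
  shows "A \<lhd> G" "closedin T A" "A \<subseteq> carrier G" "A \<noteq> {}" "\<one> \<in> A"
proof -
  show A: "A \<lhd> G" "closedin T A"
    using assms by (auto simp: closed_normal_subgroups_def)
  then show "A \<subseteq> carrier G" "\<one> \<in> A" "A \<noteq> {}"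
    using normal_imp_subgroup subgroup.subset subgroup.one_closed by fastforce+
qed

text \<open>Suprema of reals carry information only for sets bounded above; compactness supplies the
  bound for the Hausdorff metric.\<close>

lemma bounded:
  obtains B where "\<And>x y. x \<in> carrier G \<Longrightarrow> y \<in> carrier G \<Longrightarrow> \<delta> x y \<le> B"
proof -
  have "compactin \<delta>.mtopology (carrier G)"
    using compact by (simp add: mtopology_eq compact_space_def topspace_eq)
  then have "\<delta>.mbounded (carrier G)"
    by (rule \<delta>.compactin_imp_mbounded)
  then show thesis
    using that by (auto simp: \<delta>.mbounded_alt)
qed

lemma INF_less_iff_ex:
  assumes "B \<subseteq> carrier G" "B \<noteq> {}"
  shows "(INF y\<in>B. \<delta> x y) < e \<longleftrightarrow> (\<exists>y\<in>B. \<delta> x y < e)"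
proof -
  have "bdd_below ((\<lambda>y. \<delta> x y) ` B)"
    by (rule bdd_belowI2[of _ 0]) simp
  then show ?thesis
    using assms(2) by (simp add: cInf_less_iff)
qed

lemma bdd_above_INF:
  assumes "A \<subseteq> carrier G" "B \<subseteq> carrier G" "B \<noteq> {}"
  shows "bdd_above ((\<lambda>x. INF y\<in>B. \<delta> x y) ` A)"
proof -
  obtain c where c: "\<And>x y. x \<in> carrier G \<Longrightarrow> y \<in> carrier G \<Longrightarrow> \<delta> x y \<le> c"
    using bounded by blast
  obtain b where b: "b \<in> B"
    using assms(3) by blast
  have "(INF y\<in>B. \<delta> x y) \<le> c" if "x \<in> A" for x
  proof -
    have "(INF y\<in>B. \<delta> x y) \<le> \<delta> x b"
      using b by (intro cINF_lower bdd_belowI2[of _ 0]) simp_all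
    also have "\<dots> \<le> c"
      using c that b assms by blast
    finally show ?thesis .
  qed
  then show ?thesis
    by (rule bdd_aboveI2)
qed

lemma Hausdorff_metric_eq:
  assumes "A \<in> \<K>" "B \<in> \<K>"
  shows "\<H> A B = max (SUP x\<in>A. INF y\<in>B. \<delta> x y) (SUP y\<in>B. INF x\<in>A. \<delta> y x)"
  using assms by (simp add: Hausdorff_metric_def \<delta>.commute)

lemma Hausdorff_metric_commute: "\<H> A B = \<H> B A"
  by (simp add: Hausdorff_metric_def \<delta>.commute max.commute)

lemma Hausdorff_metric_lessD:
  assumes "A \<in> \<K>" "B \<in> \<K>" "\<H> A B < e" "x \<in> A"
  shows "\<exists>y\<in>B. \<delta> x y < e"
proof -
  note A = closed_normal_subgroupsD[OF assms(1)] and B = closed_normal_subgroupsD[OF assms(2)]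
  have "(INF y\<in>B. \<delta> x y) \<le> (SUP x\<in>A. INF y\<in>B. \<delta> x y)"
    using assms(4) bdd_above_INF[OF A(3) B(3,4)] by (rule cSUP_upper)
  also have "\<dots> \<le> \<H> A B"
    by (simp add: Hausdorff_metric_eq assms)
  finally have "(INF y\<in>B. \<delta> x y) < e"
    using assms(3) by simp
  then show ?thesis
    using INF_less_iff_ex B by simp
qed

text \<open>The conclusion is not strict, since a supremum of numbers below \<open>e\<close> may
  equal \<open>e\<close>. Applications needing a strict bound start from
  \<open>e / 2\<close>.\<close>

lemma Hausdorff_metric_leI:
  assumes "A \<in> \<K>" "B \<in> \<K>" "\<And>x. x \<in> A \<Longrightarrow> \<exists>y\<in>B. \<delta> x y < e" "\<And>y. y \<in> B \<Longrightarrow> \<exists>x\<in>A. \<delta> y x < e"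
  shows "\<H> A B \<le> e"
proof -
  note A = closed_normal_subgroupsD[OF assms(1)] and B = closed_normal_subgroupsD[OF assms(2)]
  have "(SUP x\<in>A. INF y\<in>B. \<delta> x y) \<le> e"
    using A(4) by (rule cSUP_least) (use assms(3) INF_less_iff_ex[OF B(3,4)] in \<open>simp add: less_imp_le\<close>)
  moreover have "(SUP y\<in>B. INF x\<in>A. \<delta> y x) \<le> e"
    using B(4) by (rule cSUP_least) (use assms(4) INF_less_iff_ex[OF A(3,4)] in \<open>simp add: less_imp_le\<close>)
  ultimately show ?thesis
    by (simp add: Hausdorff_metric_eq assms)
qed

lemma Hausdorff_metric_nonneg: "0 \<le> \<H> A B"
proof (cases "A \<in> \<K> \<and> B \<in> \<K>")
  case True
  show ?thesis
  proof (rule ccontr)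
    assume "\<not> 0 \<le> \<H> A B"
    then have "\<H> A B < 0"
      by simp
    moreover obtain x where "x \<in> A"
      using True closed_normal_subgroupsD(4) by blast
    ultimately have "\<exists>y\<in>B. \<delta> x y < 0"
      using True by (intro Hausdorff_metric_lessD) auto
    then show False
      using \<delta>.nonneg by (meson not_less)
  qed
qed (auto simp: Hausdorff_metric_def)

lemma subset_if_Hausdorff_metric_zero:
  assumes "A \<in> \<K>" "B \<in> \<K>" "\<H> A B = 0"
  shows "A \<subseteq> B"
proof (rule ccontr)
  assume "\<not> A \<subseteq> B"
  then obtain x where x: "x \<in> A" "x \<notin> B"
    by blast
  have "closedin \<delta>.mtopology B"
    using closed_normal_subgroupsD(2)[OF assms(2)] by (simp add: mtopology_eq)
  moreover have "x \<in> carrier G - B"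
    using x closed_normal_subgroupsD(3)[OF assms(1)] by blast
  ultimately obtain r where r: "r > 0" "disjnt B (\<delta>.mball x r)"
    unfolding \<delta>.closedin_metric by blast
  obtain y where y: "y \<in> B" "\<delta> x y < r"
    using Hausdorff_metric_lessD[OF assms(1,2) _ x(1), of r] assms(3) r(1) by auto
  then have "y \<in> \<delta>.mball x r"
    using \<open>x \<in> carrier G - B\<close> closed_normal_subgroupsD(3)[OF assms(2)] by auto
  then show False
    using r(2) y(1) by (auto simp: disjnt_def)
qed

sublocale \<H>: Metric_space \<K> \<H>
proof
  fix A B assume AB: "A \<in> \<K>" "B \<in> \<K>"
  show "\<H> A B = 0 \<longleftrightarrow> A = B"
  proof
    assume "\<H> A B = 0"
    then show "A = B"
      using subset_if_Hausdorff_metric_zero AB Hausdorff_metric_commute by (metis subset_antisym)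
  next
    assume "A = B"
    have "\<H> A A \<le> e" if "e > 0" for e
    proof (rule Hausdorff_metric_leI[OF AB(1,1)])
      have "\<exists>y\<in>A. \<delta> x y < e" if "x \<in> A" for x
      proof
        show "\<delta> x x < e"
          using \<open>e > 0\<close> that closed_normal_subgroupsD(3)[OF AB(1)] by auto
      qed fact
      then show "\<And>x. x \<in> A \<Longrightarrow> \<exists>y\<in>A. \<delta> x y < e" "\<And>x. x \<in> A \<Longrightarrow> \<exists>y\<in>A. \<delta> x y < e"
        by blast+
    qed
    then have "\<H> A A \<le> 0"
      by (rule field_le_epsilon[of _ 0, simplified])
    then show "\<H> A B = 0"
      using Hausdorff_metric_nonneg[of A A] \<open>A = B\<close> by simp
  qed
next
  fix A B C assume K: "A \<in> \<K>" "B \<in> \<K>" "C \<in> \<K>"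
  \<comment> \<open>Stated for variable outer sets, because the triangle inequality needs it from
    \<open>A\<close> to \<open>C\<close> and from \<open>C\<close> to \<open>A\<close>.\<close>
  have near: "\<exists>z\<in>C'. \<delta> x z < \<H> A' B + \<H> B C' + e"
    if A'C': "A' \<in> \<K>" "C' \<in> \<K>" and e: "e > 0" and x: "x \<in> A'" for A' C' x e
  proof -
    obtain y where y: "y \<in> B" "\<delta> x y < \<H> A' B + e / 2"
      using Hausdorff_metric_lessD[OF A'C'(1) K(2) _ x, of "\<H> A' B + e / 2"] e by auto
    obtain z where z: "z \<in> C'" "\<delta> y z < \<H> B C' + e / 2"
      using Hausdorff_metric_lessD[OF K(2) A'C'(2) _ y(1), of "\<H> B C' + e / 2"] e by auto
    have "\<delta> x z \<le> \<delta> x y + \<delta> y z"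
      using y z A'C' x K closed_normal_subgroupsD(3) by (intro \<delta>.triangle) blast+
    then have "\<delta> x z < \<H> A' B + \<H> B C' + e"
      using y(2) z(2) by argo
    then show ?thesis
      using z(1) by blast
  qed
  have "\<H> A C \<le> \<H> A B + \<H> B C + e" if "e > 0" for e
  proof (rule Hausdorff_metric_leI[OF K(1,3)])
    show "\<exists>z\<in>C. \<delta> x z < \<H> A B + \<H> B C + e" if "x \<in> A" for x
      using near[OF K(1,3) \<open>e > 0\<close> that] .
    show "\<exists>z\<in>A. \<delta> x z < \<H> A B + \<H> B C + e" if "x \<in> C" for x
      using near[OF K(3,1) \<open>e > 0\<close> that] Hausdorff_metric_commute[of C B]
        Hausdorff_metric_commute[of B A] by (simp add: add.commute)
  qed
  then show "\<H> A C \<le> \<H> A B + \<H> B C"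
    by (rule field_le_epsilon)
qed (simp_all add: Hausdorff_metric_nonneg Hausdorff_metric_commute)

lemma topspace_closed_normal_subgroups_topology:
  "topspace (closed_normal_subgroups_topology G T \<delta>) = \<K>"
  by (simp add: closed_normal_subgroups_topology_def)

text \<open>
  A quotient map of \<open>G Mod R\<close> lifts to a map of \<open>G\<close> whose kernel is open and
  contains \<open>R\<close>; by invariance of the metric it also contains every \<open>R'\<close> close to \<open>R\<close>.
\<close>

lemma openin_has_quotient_table:
  "openin (closed_normal_subgroups_topology G T \<delta>)
     {R \<in> \<K>. has_quotient_table (G Mod R) (FactGroup_topology G T R) c}"
  unfolding closed_normal_subgroups_topology_def \<H>.openin_mtopology
proof (intro conjI allI impI)
  fix R assume "R \<in> {R \<in> \<K>. has_quotient_table (G Mod R) (FactGroup_topology G T R) c}"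
  then have R: "R \<in> \<K>" "has_quotient_table (G Mod R) (FactGroup_topology G T R) c"
    by auto
  then obtain f where f: "f ` carrier G = {..<length c}"
    "\<And>x y. x \<in> carrier G \<Longrightarrow> y \<in> carrier G \<Longrightarrow> f (x \<otimes> y) = c ! f x ! f y"
    "\<And>i. openin T {x \<in> carrier G. f x = i}" "\<And>x. x \<in> R \<Longrightarrow> f x = f \<one>"
    unfolding has_quotient_table_FactGroup[OF closed_normal_subgroupsD(1)[OF R(1)] topspace_eq] by blast
  have "openin \<delta>.mtopology {x \<in> carrier G. f x = f \<one>}"
    using f(3) by (simp add: mtopology_eq)
  then obtain e where e: "e > 0" "\<delta>.mball \<one> e \<subseteq> {x \<in> carrier G. f x = f \<one>}"
    unfolding \<delta>.openin_mtopology by auto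
  have "R' \<in> {R \<in> \<K>. has_quotient_table (G Mod R) (FactGroup_topology G T R) c}"
    if R': "R' \<in> \<H>.mball R e" for R'
  proof -
    have R'K: "R' \<in> \<K>" "\<H> R' R < e"
      using R' by (auto simp: Hausdorff_metric_commute)
    have "f x = f \<one>" if x: "x \<in> R'" for x
    proof -
      obtain y where y: "y \<in> R" "\<delta> x y < e"
        using Hausdorff_metric_lessD[OF R'K(1) R(1) R'K(2) x] by blast
      have xy: "x \<in> carrier G" "y \<in> carrier G"
        using x y(1) closed_normal_subgroupsD(3) R(1) R'K(1) by blast+
      have "\<delta> (x \<otimes> inv y) \<one> = \<delta> x y"
        using right_invariant[of x y "inv y"] xy by simp
      then have "x \<otimes> inv y \<in> \<delta>.mball \<one> e"
        using xy y(2) by (simp add: \<delta>.commute)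
      then have "f (x \<otimes> inv y) = f \<one>"
        using e(2) by blast
      \<comment> \<open>Both factors have the value of the unit, and the table computes the value of
        a product from the values of its factors.\<close>
      then have "f (x \<otimes> inv y \<otimes> y) = f (\<one> \<otimes> \<one>)"
        using f(2)[of "x \<otimes> inv y" y] f(2)[of \<one> \<one>] f(4)[OF y(1)] xy by simp
      then show ?thesis
        using xy by (simp add: m_assoc)
    qed
    then have "has_quotient_table (G Mod R') (FactGroup_topology G T R') c"
      unfolding has_quotient_table_FactGroup[OF closed_normal_subgroupsD(1)[OF R'K(1)] topspace_eq]
      using f(1-3) by blast
    then show ?thesis
      using R'K(1) by simp
  qed
  then show "\<exists>r>0. \<H>.mball R r \<subseteq> {R \<in> \<K>. has_quotient_table (G Mod R) (FactGroup_topology G T R) c}"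
    using e(1) by blast
qed auto

end

section \<open>Measurability of the invariant on presentations\<close>

lemma compact_biinvariant_group_free_profinite:
  assumes "compatible_biinvariant_metric (free_profinite k) (free_profinite_topology k) \<delta>"
  shows "compact_biinvariant_group (free_profinite k) (free_profinite_topology k) \<delta>"
proof (intro compact_biinvariant_group.intro compact_biinvariant_group_axioms.intro)
  show "Group.group (free_profinite k)"
    unfolding free_profinite_def by (rule group_profinite_completion[OF group_free_group])
  show "compact_space (free_profinite_topology k)"
    unfolding free_profinite_topology_def by (rule compact_space_profinite_completion_topology)
qed fact

abbreviation free_quotient_has_table :: "nat \<times> free_profinite_elem set \<Rightarrow> nat list list \<Rightarrow> bool" where
  "free_quotient_has_table u c \<equiv> has_quotient_table (free_profinite (fst u) Mod snd u)
     (FactGroup_topology (free_profinite (fst u)) (free_profinite_topology (fst u)) (snd u)) c"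

context
  fixes \<delta> :: "nat \<Rightarrow> free_profinite_elem \<Rightarrow> free_profinite_elem \<Rightarrow> real"
  assumes \<delta>: "\<And>k. compatible_biinvariant_metric (free_profinite k) (free_profinite_topology k) (\<delta> k)"
begin

lemma topspace_fg_presentations:
  "topspace (fg_presentations \<delta>) =
    Sigma UNIV (\<lambda>k. closed_normal_subgroups (free_profinite k) (free_profinite_topology k))"
  unfolding fg_presentations_def
  by (simp add: o_def compact_biinvariant_group.topspace_closed_normal_subgroups_topology
      [OF compact_biinvariant_group_free_profinite[OF \<delta>]])

lemma E_fg_iff_quotient_tables:
  assumes "u \<in> topspace (fg_presentations \<delta>)" "v \<in> topspace (fg_presentations \<delta>)"
  shows "E_fg u v \<longleftrightarrow> (\<forall>c. free_quotient_has_table u c \<longleftrightarrow> free_quotient_has_table v c)"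
proof -
  obtain r R k S where uv: "u = (r, R)" "v = (k, S)"
    "R \<in> closed_normal_subgroups (free_profinite r) (free_profinite_topology r)"
    "S \<in> closed_normal_subgroups (free_profinite k) (free_profinite_topology k)"
    using assms unfolding topspace_fg_presentations by blast
  note fg = fg_profinite_FactGroup_free_profinite[OF uv(3)] fg_profinite_FactGroup_free_profinite[OF uv(4)]
  note top = fg_profinite.topspace_eq[OF fg(1)] fg_profinite.topspace_eq[OF fg(2)]
  show ?thesis
  proof
    assume "E_fg u v"
    then have iso: "topological_group_isomorphic
       (free_profinite r Mod R) (FactGroup_topology (free_profinite r) (free_profinite_topology r) R)
       (free_profinite k Mod S) (FactGroup_topology (free_profinite k) (free_profinite_topology k) S)"
      by (simp add: E_fg_def uv)
    have iso': "topological_group_isomorphic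
       (free_profinite k Mod S) (FactGroup_topology (free_profinite k) (free_profinite_topology k) S)
       (free_profinite r Mod R) (FactGroup_topology (free_profinite r) (free_profinite_topology r) R)"
      by (rule topological_group_isomorphic_sym[OF iso fg_profinite.axioms(1)[OF fg(1)] top(1)])
    show "\<forall>c. free_quotient_has_table u c \<longleftrightarrow> free_quotient_has_table v c"
      using has_quotient_table_topological_group_isomorphic[OF iso _ top(1)]
        has_quotient_table_topological_group_isomorphic[OF iso' _ top(2)] uv by auto
  next
    assume "\<forall>c. free_quotient_has_table u c \<longleftrightarrow> free_quotient_has_table v c"
    then show "E_fg u v"
      using fg_profinite_determined_by_finite_quotients[OF fg] by (simp add: E_fg_def uv)
  qed
qed

lemma openin_free_quotient_has_table:
  "openin (fg_presentations \<delta>) {u \<in> topspace (fg_presentations \<delta>). free_quotient_has_table u c}"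
proof -
  have "{R. (k, R) \<in> {u \<in> topspace (fg_presentations \<delta>). free_quotient_has_table u c}} =
      {R \<in> closed_normal_subgroups (free_profinite k) (free_profinite_topology k).
        free_quotient_has_table (k, R) c}" for k
    unfolding topspace_fg_presentations by auto
  then have "openin (closed_normal_subgroups_topology (free_profinite k) (free_profinite_topology k) (\<delta> k))
      {R. (k, R) \<in> {u \<in> topspace (fg_presentations \<delta>). free_quotient_has_table u c}}" for k
    using compact_biinvariant_group.openin_has_quotient_table
      [OF compact_biinvariant_group_free_profinite[OF \<delta>], of k c] by simp
  moreover have "{u \<in> topspace (fg_presentations \<delta>). free_quotient_has_table u c} \<subseteq>
      topspace (fg_presentations \<delta>)"
    by auto
  ultimately show ?thesis
    unfolding fg_presentations_def openin_sum_topology by (auto simp: topspace_sum_topology)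
qed

lemma borel_reducible_E_fg_real:
  "borel_reducible (fg_presentations \<delta>) E_fg (euclidean :: real topology) (=)"
proof -
  let ?X = "fg_presentations \<delta>"
  \<comment> \<open>\<open>from_nat\<close> enumerates the countable type of tables, so the
    invariant becomes a set of natural numbers.\<close>
  define q where "q u = {n. free_quotient_has_table u (from_nat n)}" for u
  define g where "g u = (\<Sum>n. if n \<in> q u then (1 / 3 :: real) ^ n else 0)" for u
  have space: "space (borel_of ?X) = topspace ?X"
    by (simp add: borel_of_def space_measure_of_conv)
  have "{u \<in> space (borel_of ?X). n \<in> q u} \<in> sets (borel_of ?X)" for n
  proof -
    have "{U. openin ?X U} \<subseteq> Pow (topspace ?X)"
      using openin_subset by blast
    then have "openin ?X U \<Longrightarrow> U \<in> sets (borel_of ?X)" for U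
      unfolding borel_of_def by (simp add: sets_measure_of)
    then show ?thesis
      using openin_free_quotient_has_table unfolding space q_def by simp
  qed
  then have "g \<in> borel_measurable (borel_of ?X)"
    unfolding g_def by (intro borel_measurable_suminf measurable_If) auto
  moreover have "E_fg u v \<longleftrightarrow> g u = g v" if "u \<in> topspace ?X" "v \<in> topspace ?X" for u v
  proof -
    have "g u = g v \<longleftrightarrow> q u = q v"
      using inj_eq[OF ternary_expansion_inj] unfolding g_def by blast
    also have "\<dots> \<longleftrightarrow> (\<forall>c. free_quotient_has_table u c \<longleftrightarrow> free_quotient_has_table v c)"
      unfolding q_def set_eq_iff mem_Collect_eq by (metis from_nat_to_nat)
    finally show ?thesis
      using E_fg_iff_quotient_tables that by simp
  qed
  ultimately show ?thesis
    unfolding borel_reducible_def borel_of_euclidean by blast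
qed

end

section \<open>Coding real numbers by sets of primes\<close>

text \<open>Such a set differs from its interior by a countable set: each remaining point ends an
  interval inside the interior, and a rational chosen in that interval identifies the point.\<close>

lemma left_open_imp_borel:
  fixes A :: "real set"
  assumes "\<And>r. r \<in> A \<Longrightarrow> \<exists>s<r. {s<..r} \<subseteq> A"
  shows "A \<in> sets borel"
proof -
  define B where "B = A - interior A"
  have "\<exists>s q. s < of_rat q \<and> of_rat q < r \<and> {s<..<r} \<subseteq> interior A" if r: "r \<in> B" for r
  proof -
    obtain s where s: "s < r" "{s<..r} \<subseteq> A"
      using assms r by (auto simp: B_def)
    obtain q where "s < of_rat q" "of_rat q < r"
      using of_rat_dense[OF s(1)] by blast
    moreover have "{s<..<r} \<subseteq> interior A"
      using s(2) by (intro interior_maximal) auto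
    ultimately show ?thesis
      by blast
  qed
  then obtain s q where sq: "\<And>r. r \<in> B \<Longrightarrow> s r < real_of_rat (q r)"
    "\<And>r. r \<in> B \<Longrightarrow> real_of_rat (q r) < r" "\<And>r. r \<in> B \<Longrightarrow> {s r<..<r} \<subseteq> interior A"
    by metis
  \<comment> \<open>The point \<open>r\<close> is not interior, so it lies outside the interval
    ending at \<open>r'\<close>; the rational chosen for \<open>r'\<close> therefore lies beyond
    \<open>r\<close>.\<close>
  have less: "real_of_rat (q r) < real_of_rat (q r')" if "r \<in> B" "r' \<in> B" "r < r'" for r r'
  proof -
    have "r \<notin> {s r'<..<r'}"
      using sq(3)[OF that(2)] that(1) by (auto simp: B_def)
    then show ?thesis
      using that(3) sq(1)[OF that(2)] sq(2)[OF that(1)] by auto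
  qed
  have "inj_on q B"
  proof (rule inj_onI)
    fix r r' assume "r \<in> B" "r' \<in> B" "q r = q r'"
    then show "r = r'"
      using less[of r r'] less[of r' r] by (cases r r' rule: linorder_cases) auto
  qed
  moreover have "countable (q ` B)"
    by simp
  ultimately have "countable B"
    by (metis countable_image_inj_on)
  then have "B \<in> sets borel"
    by (rule sets.countable[rotated]) simp
  moreover have "A = interior A \<union> B"
    using interior_subset[of A] by (auto simp: B_def)
  ultimately show ?thesis
    by (metis borel_open open_interior sets.Un)
qed

section \<open>Maps onto cyclic groups of prime order and their kernels\<close>

definition cyclic_table :: "nat \<Rightarrow> nat list list" where
  "cyclic_table p = map (\<lambda>i. map (\<lambda>j. (i + j) mod p) [0..<p]) [0..<p]"

lemma cyclic_table:
  "length (cyclic_table p) = p"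
  "i < p \<Longrightarrow> j < p \<Longrightarrow> cyclic_table p ! i ! j = (i + j) mod p"
  by (simp_all add: cyclic_table_def)

text \<open>On the free group this is the homomorphism to the integers that sends every generator to
  1.\<close>

definition exponent_sum :: "('a \<times> bool) list \<Rightarrow> int" where
  "exponent_sum w = (\<Sum>l\<leftarrow>w. if snd l then 1 else - 1)"

text \<open>Cancelling letters have opposite signs and contribute 0, so reduction preserves the
  sum.\<close>

lemma exponent_sum_foldr_cons_letter:
  "exponent_sum (foldr cons_letter u v) = exponent_sum u + exponent_sum v"
proof (induction u)
  case (Cons l u)
  have "exponent_sum (cons_letter l w) = exponent_sum [l] + exponent_sum w" for w
    by (cases w; cases l) (auto simp: exponent_sum_def)
  then show ?case
    using Cons.IH by (simp add: exponent_sum_def)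
qed (simp add: exponent_sum_def)

lemma group_free_profinite: "Group.group (free_profinite k)"
  unfolding free_profinite_def by (rule group_profinite_completion[OF group_free_group])

lemma topspace_free_profinite_topology:
  "topspace (free_profinite_topology k) = carrier (free_profinite k)"
  by (simp add: free_profinite_def free_profinite_topology_def)

lemma compact_space_free_profinite_topology: "compact_space (free_profinite_topology k)"
  unfolding free_profinite_topology_def by (rule compact_space_profinite_completion_topology)

context
  fixes k :: nat
  assumes k: "k > 0"
begin

abbreviation (input) "\<F> \<equiv> free_profinite k"
abbreviation (input) "\<F>_top \<equiv> free_profinite_topology k"

interpretation P: Group.group \<F>
  by (rule group_free_profinite)

text \<open>A continuous epimorphism onto Z/p, with the residues written as natural numbers below
  \<open>p\<close>.\<close>

definition is_residue_map :: "nat \<Rightarrow> (free_profinite_elem \<Rightarrow> nat) \<Rightarrow> bool" where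
  "is_residue_map p f \<longleftrightarrow> f ` carrier \<F> = {..<p} \<and>
     (\<forall>x\<in>carrier \<F>. \<forall>y\<in>carrier \<F>. f (x \<otimes>\<^bsub>\<F>\<^esub> y) = (f x + f y) mod p) \<and>
     (\<forall>i. openin \<F>_top {x \<in> carrier \<F>. f x = i})"

text \<open>The exponent sum modulo \<open>p\<close> has a kernel \<open>N\<close> of finite index
  in the free group. It therefore factors through the coordinate \<open>N\<close> of the
  completion.\<close>

lemma residue_map_exists:
  assumes "p > 0"
  shows "\<exists>f. is_residue_map p f"
proof -
  let ?F = "free_group {..<k}"
  interpret F: Group.group ?F
    by (rule group_free_group)
  define g where "g w = nat (exponent_sum w mod int p)" for w :: "(nat \<times> bool) list"
  have g_less: "g w < p" for w
    using assms by (simp add: g_def nat_less_iff)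
  have g_int: "int (g w) = exponent_sum w mod int p" for w
    using assms by (simp add: g_def)
  have g_mult: "g (u \<otimes>\<^bsub>?F\<^esub> v) = (g u + g v) mod p" for u v
  proof -
    have "int (g (u \<otimes>\<^bsub>?F\<^esub> v)) = int ((g u + g v) mod p)"
      by (simp add: g_int zmod_int mod_simps free_group_def exponent_sum_foldr_cons_letter)
    then show ?thesis
      by simp
  qed
  have g_one: "g \<one>\<^bsub>?F\<^esub> = 0"
    by (simp add: g_def free_group_def exponent_sum_def)
  have g_inv: "(g (inv\<^bsub>?F\<^esub> w) + g w) mod p = 0" if "w \<in> carrier ?F" for w
    using g_mult[of "inv\<^bsub>?F\<^esub> w" w] that g_one by simp
  define N where "N = {w \<in> carrier ?F. g w = 0}"
  have "subgroup N ?F"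
  proof (rule F.subgroupI)
    show "inv\<^bsub>?F\<^esub> a \<in> N" if "a \<in> N" for a
      using g_inv[of a] that g_less[of "inv\<^bsub>?F\<^esub> a"] by (simp add: N_def)
    show "a \<otimes>\<^bsub>?F\<^esub> b \<in> N" if "a \<in> N" "b \<in> N" for a b
      using that g_mult[of a b] by (simp add: N_def)
  qed (use g_one in \<open>auto simp: N_def\<close>)
  moreover have "x \<otimes>\<^bsub>?F\<^esub> h \<otimes>\<^bsub>?F\<^esub> inv\<^bsub>?F\<^esub> x \<in> N" if "x \<in> carrier ?F" "h \<in> N" for x h
    using that g_inv[of x] by (simp add: N_def g_mult mod_simps add.commute)
  ultimately have N: "N \<lhd> ?F"
    by (simp add: F.normal_inv_iff)
  have coset: "N #>\<^bsub>?F\<^esub> w = {v \<in> carrier ?F. g v = g w}" if w: "w \<in> carrier ?F" for w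
  proof (intro subset_antisym subsetI)
    fix v assume "v \<in> N #>\<^bsub>?F\<^esub> w"
    then show "v \<in> {v \<in> carrier ?F. g v = g w}"
      using w g_less[of w] by (auto simp: r_coset_def N_def g_mult)
  next
    fix v assume v: "v \<in> {v \<in> carrier ?F. g v = g w}"
    then have "v \<otimes>\<^bsub>?F\<^esub> inv\<^bsub>?F\<^esub> w \<in> N"
      using w g_inv[OF w] by (simp add: N_def g_mult add.commute)
    moreover have "v = v \<otimes>\<^bsub>?F\<^esub> inv\<^bsub>?F\<^esub> w \<otimes>\<^bsub>?F\<^esub> w"
      using v w by (simp add: F.m_assoc)
    ultimately show "v \<in> N #>\<^bsub>?F\<^esub> w"
      by (auto simp: r_coset_def)
  qed
  have "carrier (?F Mod N) \<subseteq> (\<lambda>i. {v \<in> carrier ?F. g v = i}) ` {..<p}"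
    using coset g_less by (auto simp: carrier_FactGroup)
  then have "finite (carrier (?F Mod N))"
    by (rule finite_subset) simp
  then have NI: "N \<in> finite_index_normal ?F"
    using N by (simp add: finite_index_normal_def)
  \<comment> \<open>\<open>g\<close> is constant on cosets of \<open>N\<close>, so any member of the
    coset \<open>x N\<close> gives the same value.\<close>
  define f where "f x = g (SOME w. w \<in> x N)" for x :: free_profinite_elem
  have f: "f x = g w" if "x N = N #>\<^bsub>?F\<^esub> w" "w \<in> carrier ?F" for x w
  proof -
    have "w \<in> x N"
      using that coset by simp
    then have "(SOME v. v \<in> x N) \<in> x N"
      by (rule someI)
    then show ?thesis
      unfolding f_def using that coset by simp
  qed
  have rep: "\<exists>w\<in>carrier ?F. x N = N #>\<^bsub>?F\<^esub> w" if "x \<in> carrier \<F>" for x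
    using profinite_completion_mem[OF _ NI, of x] that by (auto simp: free_profinite_def carrier_FactGroup)
  have "f ` carrier \<F> = {..<p}"
  proof (intro subset_antisym subsetI)
    fix i assume "i \<in> f ` carrier \<F>"
    then obtain x where x: "x \<in> carrier \<F>" "i = f x"
      by blast
    obtain w where "w \<in> carrier ?F" "x N = N #>\<^bsub>?F\<^esub> w"
      using rep[OF x(1)] by blast
    then show "i \<in> {..<p}"
      using f[of x w] x(2) g_less by simp
  next
    fix i assume i: "i \<in> {..<p}"
    \<comment> \<open>Powers of generator 0, which exists because \<open>k > 0\<close>, attain every
      residue.\<close>
    let ?w = "replicate i (0::nat, True)"
    have "reduced_word ?w"
      by (induction i) (auto simp: reduced_Cons hd_replicate)
    then have w: "?w \<in> carrier ?F"
      using k by (auto simp: free_group_def)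
    have "exponent_sum ?w = int i"
      by (simp add: exponent_sum_def sum_list_replicate)
    then have "g ?w = i"
      using i by (simp add: g_def)
    moreover have "to_profinite_completion ?F ?w N = N #>\<^bsub>?F\<^esub> ?w"
      using NI by (simp add: to_profinite_completion_def)
    moreover have "to_profinite_completion ?F ?w \<in> carrier \<F>"
      using F.to_profinite_completion_hom w by (auto simp: hom_def free_profinite_def)
    ultimately show "i \<in> f ` carrier \<F>"
      using f[OF _ w] by (metis image_eqI)
  qed
  moreover have "f (x \<otimes>\<^bsub>\<F>\<^esub> y) = (f x + f y) mod p" if xy: "x \<in> carrier \<F>" "y \<in> carrier \<F>" for x y
  proof -
    obtain u where u: "u \<in> carrier ?F" "x N = N #>\<^bsub>?F\<^esub> u"
      using rep[OF xy(1)] by blast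
    obtain v where v: "v \<in> carrier ?F" "y N = N #>\<^bsub>?F\<^esub> v"
      using rep[OF xy(2)] by blast
    have "(x \<otimes>\<^bsub>\<F>\<^esub> y) N = N #>\<^bsub>?F\<^esub> (u \<otimes>\<^bsub>?F\<^esub> v)"
      using u v normal.rcos_sum[OF N] by (simp add: free_profinite_def profinite_completion_mult[OF NI])
    then show ?thesis
      using f[of x, OF u(2,1)] f[of y, OF v(2,1)] f[of "x \<otimes>\<^bsub>\<F>\<^esub> y"] u(1) v(1) g_mult by simp
  qed
  moreover have "openin \<F>_top {x \<in> carrier \<F>. f x = i}" for i
    using openin_profinite_completion_fibre[OF NI, of "{C. g (SOME w. w \<in> C) = i}"]
    by (simp add: f_def free_profinite_def free_profinite_topology_def)
  ultimately show ?thesis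
    unfolding is_residue_map_def by blast
qed

text \<open>An arbitrary choice for each \<open>p\<close>; later arguments reach it through
  \<open>is_residue_map\<close>.\<close>

definition residue_map :: "nat \<Rightarrow> free_profinite_elem \<Rightarrow> nat" where
  "residue_map p = (SOME f. is_residue_map p f)"

lemma is_residue_map_residue_map: "p > 0 \<Longrightarrow> is_residue_map p (residue_map p)"
  unfolding residue_map_def by (rule someI_ex[OF residue_map_exists])

text \<open>The map is kept general because these facts are applied to two kinds of maps: the chosen
  \<open>residue_map p\<close> and an unknown map obtained from a cyclic table.\<close>

context
  fixes p :: nat and f :: "free_profinite_elem \<Rightarrow> nat"
  assumes f: "is_residue_map p f"
begin

lemma residue_map_less: "x \<in> carrier \<F> \<Longrightarrow> f x < p"
  using f by (auto simp: is_residue_map_def)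

lemma residue_map_mult:
  "x \<in> carrier \<F> \<Longrightarrow> y \<in> carrier \<F> \<Longrightarrow> f (x \<otimes>\<^bsub>\<F>\<^esub> y) = (f x + f y) mod p"
  using f by (simp add: is_residue_map_def)

lemma residue_map_one: "f \<one>\<^bsub>\<F>\<^esub> = 0"
proof -
  have "f \<one>\<^bsub>\<F>\<^esub> = (f \<one>\<^bsub>\<F>\<^esub> + f \<one>\<^bsub>\<F>\<^esub>) mod p" "f \<one>\<^bsub>\<F>\<^esub> < p"
    using residue_map_mult[of "\<one>\<^bsub>\<F>\<^esub>" "\<one>\<^bsub>\<F>\<^esub>"] residue_map_less[of "\<one>\<^bsub>\<F>\<^esub>"] by simp_all
  then show ?thesis
    \<comment> \<open>Write a for the value at the unit. If 2a is at least \<open>p\<close>, its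
      remainder is 2a - p; equality with a would force a = p.\<close>
    by (cases "f \<one>\<^bsub>\<F>\<^esub> + f \<one>\<^bsub>\<F>\<^esub> < p") (auto simp: le_mod_geq not_less)
qed

lemma residue_map_inv:
  "x \<in> carrier \<F> \<Longrightarrow> (f x + f (inv\<^bsub>\<F>\<^esub> x)) mod p = 0"
  using residue_map_mult[of x "inv\<^bsub>\<F>\<^esub> x"] residue_map_one by simp

lemma residue_map_pow:
  "x \<in> carrier \<F> \<Longrightarrow> f (x [^]\<^bsub>\<F>\<^esub> (m::nat)) = (m * f x) mod p"
  by (induction m) (simp_all add: residue_map_one residue_map_mult mod_simps add.commute)

lemma residue_map_kernel_normal: "{x \<in> carrier \<F>. f x = 0} \<lhd> \<F>"
proof -
  have "subgroup {x \<in> carrier \<F>. f x = 0} \<F>"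
  proof (rule P.subgroupI)
    show "inv\<^bsub>\<F>\<^esub> a \<in> {x \<in> carrier \<F>. f x = 0}" if "a \<in> {x \<in> carrier \<F>. f x = 0}" for a
      using that residue_map_inv[of a] residue_map_less[of "inv\<^bsub>\<F>\<^esub> a"] by simp
    show "a \<otimes>\<^bsub>\<F>\<^esub> b \<in> {x \<in> carrier \<F>. f x = 0}"
      if "a \<in> {x \<in> carrier \<F>. f x = 0}" "b \<in> {x \<in> carrier \<F>. f x = 0}" for a b
      using that residue_map_mult[of a b] by simp
  qed (use residue_map_one in auto)
  moreover have "f (x \<otimes>\<^bsub>\<F>\<^esub> h \<otimes>\<^bsub>\<F>\<^esub> inv\<^bsub>\<F>\<^esub> x) = 0" if "x \<in> carrier \<F>" "h \<in> carrier \<F>" "f h = 0" for x h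
    using that residue_map_inv[of x] by (simp add: residue_map_mult mod_simps)
  ultimately show ?thesis
    by (simp add: P.normal_inv_iff)
qed

lemma residue_map_kernel_closed: "closedin \<F>_top {x \<in> carrier \<F>. f x = 0}"
proof -
  have "openin \<F>_top (\<Union>i\<in>{i. i \<noteq> 0}. {x \<in> carrier \<F>. f x = i})"
    using f unfolding is_residue_map_def by blast
  also have "(\<Union>i\<in>{i. i \<noteq> 0}. {x \<in> carrier \<F>. f x = i}) = topspace \<F>_top - {x \<in> carrier \<F>. f x = 0}"
    by (auto simp: topspace_free_profinite_topology)
  finally show ?thesis
    by (auto simp: closedin_def topspace_free_profinite_topology)
qed

end

definition residue_kernel :: "nat set \<Rightarrow> free_profinite_elem set" where
  "residue_kernel A = {x \<in> carrier \<F>. \<forall>p\<in>A. residue_map p x = 0}"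

lemma residue_kernel_antimono: "A \<subseteq> B \<Longrightarrow> residue_kernel B \<subseteq> residue_kernel A"
  by (auto simp: residue_kernel_def)

lemma residue_kernel_closed_normal:
  assumes "\<And>p. p \<in> A \<Longrightarrow> p > 0"
  shows "residue_kernel A \<in> closed_normal_subgroups \<F> \<F>_top"
proof -
  \<comment> \<open>Inserting the whole carrier makes the intersection correct for empty
    \<open>A\<close>.\<close>
  let ?K = "insert (carrier \<F>) ((\<lambda>p. {x \<in> carrier \<F>. residue_map p x = 0}) ` A)"
  have eq: "residue_kernel A = \<Inter>?K"
    by (auto simp: residue_kernel_def)
  have normal: "K \<lhd> \<F>" if "K \<in> ?K" for K
    using that assms residue_map_kernel_normal[OF is_residue_map_residue_map]
    by (auto simp: P.normal_inv_iff P.subgroup_self)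
  have "closedin \<F>_top K" if "K \<in> ?K" for K
    using that assms residue_map_kernel_closed[OF is_residue_map_residue_map]
      closedin_topspace[of \<F>_top] by (auto simp: topspace_free_profinite_topology)
  then have "closedin \<F>_top (\<Inter>?K)"
    by (intro closedin_Inter) auto
  moreover have "subgroup (\<Inter>?K) \<F>"
  proof (rule P.subgroups_Inter)
    show "subgroup K \<F>" if "K \<in> ?K" for K
      using normal[OF that] by (rule normal_imp_subgroup)
  qed blast
  then have "\<Inter>?K \<lhd> \<F>"
    unfolding P.normal_inv_iff
    using normal.inv_op_closed2[OF normal] by (intro conjI ballI InterI) (assumption, blast)
  ultimately show ?thesis
    unfolding eq closed_normal_subgroups_def by simp
qed

text \<open>The closed kernels for the members of \<open>A\<close> have no common point outside
  \<open>U\<close>. By compactness finitely many of them already have none.\<close>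

lemma residue_kernel_finite_approx:
  assumes A: "\<And>p. p \<in> A \<Longrightarrow> p > 0" and U: "openin \<F>_top U" "residue_kernel A \<subseteq> U"
  shows "\<exists>F\<subseteq>A. finite F \<and> residue_kernel F \<subseteq> U"
proof (rule ccontr)
  assume none: "\<not> ?thesis"
  let ?Z = "\<lambda>p. {x \<in> carrier \<F>. residue_map p x = 0}"
  define C where "C = topspace \<F>_top - U"
  define \<U> where "\<U> = insert C (?Z ` A)"
  have closed: "closedin \<F>_top K" if "K \<in> \<U>" for K
    using that U(1) A residue_map_kernel_closed[OF is_residue_map_residue_map]
    by (auto simp: \<U>_def C_def)
  have fip: "\<Inter>\<C> \<noteq> {}" if \<C>: "finite \<C>" "\<C> \<subseteq> \<U>" for \<C>
  proof -
    \<comment> \<open>Apart from \<open>C\<close>, the subfamily consists of kernels indexed by a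
      finite \<open>F\<close>. Since the common kernel of \<open>F\<close> is not contained in
      \<open>U\<close>, it meets \<open>C\<close>.\<close>
    have "finite (\<C> - {C})" "\<C> - {C} \<subseteq> ?Z ` A"
      using \<C> by (auto simp: \<U>_def)
    then have "\<exists>F\<subseteq>A. finite F \<and> \<C> - {C} = ?Z ` F"
      by (rule finite_subset_image)
    then obtain F where F: "F \<subseteq> A" "finite F" "\<C> - {C} = ?Z ` F"
      by auto
    have "\<not> residue_kernel F \<subseteq> U"
      using none F(1,2) by simp
    then obtain x where "x \<in> residue_kernel F" "x \<notin> U"
      by auto
    then have "x \<in> C" "\<forall>K\<in>\<C> - {C}. x \<in> K"
      unfolding F(3) by (auto simp: residue_kernel_def C_def topspace_free_profinite_topology)
    then show ?thesis
      by blast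
  qed
  have "(\<forall>K\<in>\<U>. closedin \<F>_top K) \<and> (\<forall>\<C>. finite \<C> \<and> \<C> \<subseteq> \<U> \<longrightarrow> \<Inter>\<C> \<noteq> {}) \<longrightarrow> \<Inter>\<U> \<noteq> {}"
    using compact_space_free_profinite_topology[of k] unfolding compact_space_fip by (rule spec)
  then have "\<Inter>\<U> \<noteq> {}"
    using closed fip by simp
  then obtain x where "x \<in> C" "\<forall>p\<in>A. x \<in> ?Z p"
    by (auto simp: \<U>_def)
  then show False
    using U(2) by (auto simp: residue_kernel_def C_def topspace_free_profinite_topology)
qed

text \<open>If \<open>p\<close> is not in \<open>A\<close>, a map \<open>f\<close> with this table
  is trivial on the common kernel of a finite \<open>F\<close> inside \<open>A\<close>. The power of
  any \<open>x\<close> with exponent the product of \<open>F\<close> lies in this kernel. As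
  \<open>p\<close> does not divide the exponent, \<open>f x\<close> is already 0, so
  \<open>f\<close> is not onto.\<close>

lemma residue_kernel_has_cyclic_table:
  assumes A: "\<And>p. p \<in> A \<Longrightarrow> prime p" and p: "prime p"
  shows "free_quotient_has_table (k, residue_kernel A) (cyclic_table p) \<longleftrightarrow> p \<in> A"
proof -
  have pos: "\<And>q. q \<in> A \<Longrightarrow> q > 0"
    using A prime_gt_0_nat by blast
  have "residue_kernel A \<lhd> \<F>"
    using residue_kernel_closed_normal[of A] pos by (simp add: closed_normal_subgroups_def)
  note table = has_quotient_table_FactGroup[OF this topspace_free_profinite_topology, of "cyclic_table p", unfolded cyclic_table(1)]
  show ?thesis
  proof
    assume "p \<in> A"
    have res: "is_residue_map p (residue_map p)"
      using p by (intro is_residue_map_residue_map) (simp add: prime_gt_0_nat)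
    show "free_quotient_has_table (k, residue_kernel A) (cyclic_table p)"
      unfolding fst_conv snd_conv table
    proof (intro exI[of _ "residue_map p"] conjI ballI allI)
      show "residue_map p ` carrier \<F> = {..<p}" "openin \<F>_top {x \<in> carrier \<F>. residue_map p x = i}" for i
        using res by (simp_all add: is_residue_map_def)
      show "residue_map p (x \<otimes>\<^bsub>\<F>\<^esub> y) = cyclic_table p ! residue_map p x ! residue_map p y"
        if "x \<in> carrier \<F>" "y \<in> carrier \<F>" for x y
        using that by (simp add: cyclic_table residue_map_less[OF res] residue_map_mult[OF res])
      show "residue_map p x = residue_map p \<one>\<^bsub>\<F>\<^esub>" if "x \<in> residue_kernel A" for x
        using that \<open>p \<in> A\<close> residue_map_one[OF res] by (simp add: residue_kernel_def)
    qed
  next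
    assume "free_quotient_has_table (k, residue_kernel A) (cyclic_table p)"
    then obtain f where f: "f ` carrier \<F> = {..<p}"
      "\<And>x y. x \<in> carrier \<F> \<Longrightarrow> y \<in> carrier \<F> \<Longrightarrow> f (x \<otimes>\<^bsub>\<F>\<^esub> y) = cyclic_table p ! f x ! f y"
      "\<And>i. openin \<F>_top {x \<in> carrier \<F>. f x = i}" "\<And>x. x \<in> residue_kernel A \<Longrightarrow> f x = f \<one>\<^bsub>\<F>\<^esub>"
      unfolding fst_conv snd_conv table by blast
    have "f x < p" if "x \<in> carrier \<F>" for x
      using f(1) that by blast
    then have res: "is_residue_map p f"
      using f(1-3) by (simp add: is_residue_map_def cyclic_table)
    show "p \<in> A"
    proof (rule ccontr)
      assume "p \<notin> A"
      have "residue_kernel A \<subseteq> {x \<in> carrier \<F>. f x = 0}"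
        using f(4) residue_map_one[OF res] by (auto simp: residue_kernel_def)
      with residue_kernel_finite_approx[OF pos f(3)]
      obtain F where F: "finite F" "F \<subseteq> A" "residue_kernel F \<subseteq> {x \<in> carrier \<F>. f x = 0}"
        by meson
      have ndvd: "\<not> p dvd \<Prod>F"
      proof
        assume "p dvd \<Prod>F"
        then obtain q where "q \<in> F" "p dvd q"
          using prime_dvd_prod_iff[OF F(1) p, of "\<lambda>q. q"] by auto
        then show False
          using A F(2) p \<open>p \<notin> A\<close> primes_dvd_imp_eq by blast
      qed
      have "f x = 0" if x: "x \<in> carrier \<F>" for x
      proof -
        have "residue_map q (x [^]\<^bsub>\<F>\<^esub> \<Prod>F) = 0" if q: "q \<in> F" for q
        proof -
          have "q dvd \<Prod>F"
            using q F(1) by (rule dvd_prodI[rotated])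
          then have "(\<Prod>F * residue_map q x) mod q = 0"
            by simp
          then show ?thesis
            using residue_map_pow[OF is_residue_map_residue_map x, of q "\<Prod>F"] pos q F(2) by auto
        qed
        then have "x [^]\<^bsub>\<F>\<^esub> \<Prod>F \<in> residue_kernel F"
          using x by (simp add: residue_kernel_def)
        then have "(\<Prod>F * f x) mod p = 0"
          using F(3) residue_map_pow[OF res x] by auto
        then have "p dvd f x"
          using ndvd p by (simp add: mod_eq_0_iff_dvd prime_dvd_mult_iff)
        then show ?thesis
          using residue_map_less[OF res x] by (auto dest: dvd_imp_le)
      qed
      then have "f ` carrier \<F> \<subseteq> {0}"
        by auto
      moreover have "1 < p"
        using p by (rule prime_gt_1_nat)
      ultimately show False
        using f(1) by auto
    qed
  qed
qed

end

section \<open>Dedekind cuts as sets of primes\<close>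

definition prime_of_rat :: "rat \<Rightarrow> nat" where
  "prime_of_rat q = enumerate {p. prime p} (to_nat q)"

lemma prime_prime_of_rat: "prime (prime_of_rat q)"
  using enumerate_in_set[OF primes_infinite] by (simp add: prime_of_rat_def)

lemma prime_of_rat_eq_iff: "prime_of_rat q = prime_of_rat q' \<longleftrightarrow> q = q'"
  using strict_mono_enumerate[OF primes_infinite, THEN strict_mono_eq] by (simp add: prime_of_rat_def)

definition primes_below :: "real \<Rightarrow> nat set" where
  "primes_below r = prime_of_rat ` {q. real_of_rat q < r}"

lemma prime_of_rat_primes_below: "prime_of_rat q \<in> primes_below r \<longleftrightarrow> real_of_rat q < r"
  by (auto simp: primes_below_def prime_of_rat_eq_iff)

lemma primes_below_prime: "p \<in> primes_below r \<Longrightarrow> prime p"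
  by (auto simp: primes_below_def prime_prime_of_rat)

lemma primes_below_pos: "p \<in> primes_below r \<Longrightarrow> p > 0"
  by (simp add: primes_below_prime prime_gt_0_nat)

lemma primes_below_mono: "r \<le> s \<Longrightarrow> primes_below r \<subseteq> primes_below s"
  by (auto simp: primes_below_def)

text \<open>This is where the strict inequality in the cut matters: finitely many rationals below
  \<open>r\<close> stay below some \<open>s < r\<close>. It is the source of left
  continuity.\<close>

lemma finite_subset_primes_below:
  assumes "finite F" "F \<subseteq> primes_below r"
  shows "\<exists>s<r. F \<subseteq> primes_below s"
  using assms
proof (induction F)
  case empty
  show ?case
    by (rule exI[of _ "r - 1"]) simp
next
  case (insert p F)
  then obtain s where s: "s < r" "F \<subseteq> primes_below s"
    by auto
  obtain q where q: "p = prime_of_rat q" "real_of_rat q < r"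
    using insert.prems by (auto simp: primes_below_def)
  obtain t where t: "max s (real_of_rat q) < t" "t < r"
    using dense[of "max s (real_of_rat q)" r] s(1) q(2) by auto
  then have "F \<subseteq> primes_below t" "p \<in> primes_below t"
    using s(2) primes_below_mono[of s t] q(1) by (auto simp: prime_of_rat_primes_below)
  then show ?case
    using t(2) by blast
qed

context
  fixes k :: nat
  assumes k: "k > 0"
begin

lemma residue_kernel_primes_below:
  "residue_kernel k (primes_below r) \<in>
    closed_normal_subgroups (free_profinite k) (free_profinite_topology k)"
  by (rule residue_kernel_closed_normal[OF k]) (rule primes_below_pos)

text \<open>
  Approaching \<open>r\<close> from the left, the compact groups \<open>residue_kernel k (primes_below t)\<close> decrease
  to their intersection \<open>residue_kernel k (primes_below r)\<close>, so they converge to it in the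
  Hausdorff metric.
\<close>

lemma residue_kernel_left_continuous:
  assumes \<delta>: "compatible_biinvariant_metric (free_profinite k) (free_profinite_topology k) \<delta>"
    and V: "openin (closed_normal_subgroups_topology (free_profinite k) (free_profinite_topology k) \<delta>) V" "residue_kernel k (primes_below r) \<in> V"
  shows "\<exists>s<r. \<forall>t. s < t \<and> t \<le> r \<longrightarrow> residue_kernel k (primes_below t) \<in> V"
proof -
  interpret compact_biinvariant_group "free_profinite k" "free_profinite_topology k" \<delta>
    by (rule compact_biinvariant_group_free_profinite[OF \<delta>])
  let ?R = "\<lambda>t. residue_kernel k (primes_below t)"
  obtain e where e: "e > 0" "\<H>.mball (?R r) e \<subseteq> V"
    using V unfolding closed_normal_subgroups_topology_def \<H>.openin_mtopology by blast
  \<comment> \<open>Radius \<open>e / 2\<close> leaves room to turn the non-strict Hausdorff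
    estimate into membership in the open ball of radius \<open>e\<close>.\<close>
  define U where "U = (\<Union>y\<in>?R r. \<delta>.mball y (e / 2))"
  have "openin (free_profinite_topology k) U"
    unfolding U_def using \<delta>.openin_mball by (intro openin_Union) (auto simp: mtopology_eq)
  moreover have "?R r \<subseteq> U"
    using e(1) closed_normal_subgroupsD(3)[OF residue_kernel_primes_below[of r]] by (force simp: U_def)
  ultimately obtain F where F: "finite F" "F \<subseteq> primes_below r" "residue_kernel k F \<subseteq> U"
    using residue_kernel_finite_approx[OF k, of "primes_below r" U] primes_below_pos by meson
  obtain s where s: "s < r" "F \<subseteq> primes_below s"
    using finite_subset_primes_below[OF F(1,2)] by blast
  have "?R t \<in> V" if t: "s < t" "t \<le> r" for t
  proof -
    have sub: "?R r \<subseteq> ?R t" "?R t \<subseteq> U"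
      using F(3) s(2) primes_below_mono[of s t] primes_below_mono[of t r] t
        residue_kernel_antimono[OF k, of F "primes_below t"]
        residue_kernel_antimono[OF k, of "primes_below t" "primes_below r"] by auto
    have "\<H> (?R r) (?R t) \<le> e / 2"
    proof (rule Hausdorff_metric_leI[OF residue_kernel_primes_below residue_kernel_primes_below])
      fix x assume x: "x \<in> ?R r"
      then have "\<delta> x x < e / 2"
        using e(1) closed_normal_subgroupsD(3)[OF residue_kernel_primes_below[of r]] by auto
      then show "\<exists>y\<in>?R t. \<delta> x y < e / 2"
        using x sub(1) by blast
    next
      fix y assume "y \<in> ?R t"
      then obtain x where "x \<in> ?R r" "\<delta> x y < e / 2"
        using sub(2) by (auto simp: U_def)
      then show "\<exists>x\<in>?R r. \<delta> y x < e / 2"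
        using \<delta>.commute by metis
    qed
    then have "?R t \<in> \<H>.mball (?R r) e"
      using e(1) residue_kernel_primes_below by simp
    then show ?thesis
      using e(2) by blast
  qed
  then show ?thesis
    using s(1) by blast
qed

lemma borel_reducible_real_E_fg:
  fixes \<delta> :: "nat \<Rightarrow> free_profinite_elem \<Rightarrow> free_profinite_elem \<Rightarrow> real"
  assumes \<delta>: "\<And>k. compatible_biinvariant_metric (free_profinite k) (free_profinite_topology k) (\<delta> k)"
  shows "borel_reducible (euclidean :: real topology) (=) (fg_presentations \<delta>) E_fg"
proof -
  let ?X = "fg_presentations \<delta>"
  define g where "g r = (k, residue_kernel k (primes_below r))" for r
  have g_mem: "g r \<in> topspace ?X" for r
    using residue_kernel_primes_below by (simp add: g_def topspace_fg_presentations[OF \<delta>])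
  have "g \<in> measurable borel (borel_of ?X)"
    unfolding borel_of_def
  proof (rule measurable_measure_of)
    show "{U. openin ?X U} \<subseteq> Pow (topspace ?X)"
      using openin_subset by blast
    show "g \<in> space borel \<rightarrow> topspace ?X"
      using g_mem by auto
    fix U assume "U \<in> {U. openin ?X U}"
    then have V: "openin (closed_normal_subgroups_topology (free_profinite k) (free_profinite_topology k) (\<delta> k)) {R. (k, R) \<in> U}"
      by (simp add: fg_presentations_def openin_sum_topology)
    \<comment> \<open>Left continuity makes the preimage of an open set left-open, which is enough
      for it to be Borel.\<close>
    have "g -` U \<in> sets borel"
    proof (rule left_open_imp_borel)
      fix r assume "r \<in> g -` U"
      then show "\<exists>s<r. {s<..r} \<subseteq> g -` U"
        using residue_kernel_left_continuous[OF \<delta> V, of r] by (auto simp: g_def subset_iff)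
    qed
    then show "g -` U \<inter> space borel \<in> sets borel"
      by simp
  qed
  moreover have table: "free_quotient_has_table (g r) (cyclic_table (prime_of_rat q)) \<longleftrightarrow>
      prime_of_rat q \<in> primes_below r" for r q
    unfolding g_def by (rule residue_kernel_has_cyclic_table[OF k primes_below_prime prime_prime_of_rat])
  have "r = s \<longleftrightarrow> E_fg (g r) (g s)" for r s
  proof
    assume "r = s"
    then show "E_fg (g r) (g s)"
      using E_fg_iff_quotient_tables[OF \<delta> g_mem g_mem] by simp
  next
    assume "E_fg (g r) (g s)"
    then have "free_quotient_has_table (g r) (cyclic_table p) \<longleftrightarrow> free_quotient_has_table (g s) (cyclic_table p)" for p
      using E_fg_iff_quotient_tables[OF \<delta> g_mem g_mem] by blast
    then have "prime_of_rat q \<in> primes_below r \<longleftrightarrow> prime_of_rat q \<in> primes_below s" for q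
      by (simp only: table [symmetric])
    then have iff: "real_of_rat q < r \<longleftrightarrow> real_of_rat q < s" for q
      by (simp add: prime_of_rat_primes_below)
    show "r = s"
    proof (rule ccontr)
      assume "r \<noteq> s"
      then consider "r < s" | "s < r"
        by linarith
      then show False
        \<comment> \<open>A rational strictly between the two reals belongs to just one of the
          cuts.\<close>
        using of_rat_dense[of r s] of_rat_dense[of s r] iff by cases (meson less_asym)+
    qed
  qed
  ultimately show ?thesis
    unfolding borel_reducible_def borel_of_euclidean by blast
qed

end

theorem theorem3p1:
  fixes \<delta> :: "nat \<Rightarrow> free_profinite_elem \<Rightarrow> free_profinite_elem \<Rightarrow> real"
  assumes "\<And>k. compatible_biinvariant_metric (free_profinite k) (free_profinite_topology k) (\<delta> k)"
  shows "borel_equivalent (fg_presentations \<delta>) E_fg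
           (euclidean :: real topology) ((=) :: real \<Rightarrow> real \<Rightarrow> bool)"
  unfolding borel_equivalent_def
  \<comment> \<open>\<open>zero_less_one\<close> sets the number of generators to 1: the reals are
    coded by procyclic groups.\<close>
  using borel_reducible_E_fg_real[OF assms] borel_reducible_real_E_fg[OF zero_less_one assms] by blast

end
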